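(* Fix $p\ge1$ and an integer $q_{min}\ge0$. Let $(x_t)_{t\ge1}$ be i.i.d. random vectors in $\mathbb R^p$, $P(\tau)=\big(\tau,\sum_{t=1}^{\tau}x_t\big)\in\mathbb R^{p+1}$, and let $V_n^p$ be the number of vertices of the convex hull of $\{P(\tau)\}_{\tau\in\{1,\dots,n-1\}}$. Assume: (Assumption 1) there are positive constants $c_1,c_2$ such that $\mathbb E[V_n^p]\le c_1\log(n)^p+c_2$ for all $n\ge 1$; (Assumption 2) the convex hull algorithm used has worst-case time $Time(m)$ on $m$ points satisfying $Time(m)\le c_3m^2+c_4$ for positive constants $c_3,c_4$. Then the expected time complexity of the dyadic candidate-update algorithm, and of the dyadic MdFOCuS changepoint detection algorithm, both described in the context, run up to time $n$, is $\mathcal O\big(n\log(n)^{p+1}\big)$.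
   Context: Dyadic update. The algorithm maintains a set $\mathcal T$ of indices, initially empty. When index $n$ ($n=1,2,\dots$) is processed: (i) $\mathcal T\leftarrow\mathcal T\cup\{n\}$ and $q\leftarrow q_{min}$; (ii) while $2^q$ divides $n$: let $\mathcal T'=\{\tau\in\mathcal T:\tau>n-2^q\}$; let $\mathcal T''\subseteq\mathcal T'$ be the set of $\tau\in\mathcal T'$ such that $P(\tau)$ is a vertex of the convex hull of $\{P(\tau')\}_{\tau'\in\mathcal T'}$, computed by one call of the convex hull algorithm, at cost at most $Time(|\mathcal T'|)$; replace $\mathcal T$ by $\mathcal T\setminus(\mathcal T'\setminus\mathcal T'')$; replace $q$ by $q+1$. Dyadic MdFOCuS. It maintains a set $\mathcal T$ of indices, initially empty, by the dyadic update: when index $n$ is processed, $n$ is added to $\mathcal T$, and then, successively for $q=q_{min},q_{min}+1,\dots$ as long as $2^q$ divides $n$, all $\tau\in\mathcal T'=\{\tau\in\mathcal T:\tau>n-2^q\}$ for which $P(\tau)$ is not a vertex of the convex hull of $\{P(\tau')\}_{\tau'\in\mathcal T'}$ are removed from $\mathcal T$, using one call of the convex hull algorithm at cost at most $Time(|\mathcal T'|)$ for each such $q$. In addition, at each time step, it evaluates the generalized likelihood ratio statistic $\max_{\eta_1,\eta_2}\ell_{\tau,n}(\eta_1,\eta_2)$ (with $\eta_1$ fixed if it is known) for each candidate $\tau$ in the current set $\mathcal T$, at a cost bounded by a constant (depending on $p$) per candidate, and takes the maximum over $\mathcal T$. The time complexity up to time $n$ is the total cost of the hull calls (plus bookkeeping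 linear in $|\mathcal T|$ per time step or loop iteration) and, for the second algorithm, of the statistic evaluations, over all time steps up to $n$. The expectation is over the data. *)

theory Defs
  imports "HOL-Probability.Probability" "HOL-Library.Landau_Symbols"
begin

text \<open>The space of dimension \<open>p + 1\<close> is rendered as the product \<open>real \<times> 'v\<close>, where \<open>'v\<close> has
  dimension \<open>p\<close>. Data sequences are indexed from 1; the value at index 0 has no meaning.\<close>

definition P :: "(nat \<Rightarrow> 'v::real_vector) \<Rightarrow> nat \<Rightarrow> real \<times> 'v" where
  "P x \<tau> = (real \<tau>, \<Sum>t=1..\<tau>. x t)"

definition hull_vertices :: "'b::real_vector set \<Rightarrow> 'b set" where
  "hull_vertices S = {v. v extreme_point_of (convex hull S)}"

definition num_vertices :: "(nat \<Rightarrow> 'v::real_vector) \<Rightarrow> nat \<Rightarrow> nat" where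
  "num_vertices x n = card (hull_vertices (P x ` {1..n-1}))"

text \<open>Actual costs of the elementary operations:
  \<^item> \<open>hull_cost S\<close>: one call of the convex hull algorithm on the point set \<open>S\<close>;
  \<^item> \<open>step_cost T\<close>: bookkeeping of one time step, with \<open>T\<close> the set right after the insertion of
    the new index (which is the maximum of \<open>T\<close>);
  \<^item> \<open>iter_cost q T\<close>: bookkeeping of the loop iteration for \<open>q\<close>, entered with the set \<open>T\<close>;
  \<^item> \<open>stat_cost \<tau> n x\<close>: one evaluation of the statistic of candidate \<open>\<tau>\<close> at time \<open>n\<close> on data \<open>x\<close>.\<close>

record 'v cost_model =
  hull_cost :: "(real \<times> 'v) set \<Rightarrow> real"
  step_cost :: "nat set \<Rightarrow> real"
  iter_cost :: "nat \<Rightarrow> nat set \<Rightarrow> real"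
  stat_cost :: "nat \<Rightarrow> nat \<Rightarrow> (nat \<Rightarrow> 'v) \<Rightarrow> real"

text \<open>The while loop, on a pair of the current index set and the cost accumulated so far. The
  guard \<open>0 < n\<close> only makes the loop total: time starts at 1. The truncated subtraction
  \<open>n - 2 ^ q\<close> is exact because \<open>2 ^ q\<close> divides \<open>n\<close>.\<close>

function prune ::
  "'v::real_vector cost_model \<Rightarrow> (nat \<Rightarrow> 'v) \<Rightarrow> nat \<Rightarrow> nat \<Rightarrow> nat set \<times> real \<Rightarrow> nat set \<times> real"
where
  "prune C x n q (T, c) =
    (if 0 < n \<and> 2 ^ q dvd n then
       let T' = {\<tau> \<in> T. \<tau> > n - 2 ^ q};
           T'' = {\<tau> \<in> T'. P x \<tau> \<in> hull_vertices (P x ` T')}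
       in prune C x n (Suc q)
            (T - (T' - T''), c + hull_cost C (P x ` T') + iter_cost C q T)
     else (T, c))"
  by pat_completeness auto
termination
proof (relation "Wellfounded.measure (\<lambda>(C, x, n, q, s). n - q)", goal_cases)
  case (2 C x n q T c)
  then have "(2::nat) ^ q \<le> n"
    by (auto intro: dvd_imp_le)
  with less_exp[of q] have "q < n"
    by linarith
  then show ?case
    by simp
qed simp

declare prune.simps [simp del]

definition dyadic_update ::
  "'v::real_vector cost_model \<Rightarrow> nat \<Rightarrow> (nat \<Rightarrow> 'v) \<Rightarrow> nat \<Rightarrow> nat set \<times> real \<Rightarrow> nat set \<times> real"
where
  "dyadic_update C qmin x n s =
    (let T = insert n (fst s) in prune C x n qmin (T, snd s + step_cost C T))"

primrec dyadic_run ::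
  "'v::real_vector cost_model \<Rightarrow> nat \<Rightarrow> (nat \<Rightarrow> 'v) \<Rightarrow> nat \<Rightarrow> nat set \<times> real"
where
  "dyadic_run C qmin x 0 = ({}, 0)"
| "dyadic_run C qmin x (Suc n) = dyadic_update C qmin x (Suc n) (dyadic_run C qmin x n)"

definition dyadic_cost ::
  "'v::real_vector cost_model \<Rightarrow> nat \<Rightarrow> (nat \<Rightarrow> 'v) \<Rightarrow> nat \<Rightarrow> real" where
  "dyadic_cost C qmin x n = snd (dyadic_run C qmin x n)"

text \<open>The generalized likelihood ratio statistic for a log-likelihood ratio
  \<open>ell \<tau> n \<eta>1 \<eta>2 x\<close>. The set \<open>H\<close> contains the pairs of parameters to be maximised over; a known
  \<open>\<eta>1\<close> corresponds to \<open>H = {\<eta>1} \<times> E\<close>.\<close>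

definition glr ::
  "(nat \<Rightarrow> nat \<Rightarrow> 'e \<Rightarrow> 'e \<Rightarrow> (nat \<Rightarrow> 'v) \<Rightarrow> real) \<Rightarrow> ('e \<times> 'e) set \<Rightarrow> (nat \<Rightarrow> 'v) \<Rightarrow>
   nat \<Rightarrow> nat \<Rightarrow> ereal"
where
  "glr ell H x n \<tau> = (SUP (\<eta>1, \<eta>2) \<in> H. ereal (ell \<tau> n \<eta>1 \<eta>2 x))"

text \<open>The run up to time \<open>n\<close> yields the index set, the maximal statistics of the successive time
  steps (latest first) and the accumulated cost.\<close>

primrec md_focus_run ::
  "'v::real_vector cost_model \<Rightarrow> (nat \<Rightarrow> nat \<Rightarrow> 'e \<Rightarrow> 'e \<Rightarrow> (nat \<Rightarrow> 'v) \<Rightarrow> real) \<Rightarrow> ('e \<times> 'e) set \<Rightarrow>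
   nat \<Rightarrow> (nat \<Rightarrow> 'v) \<Rightarrow> nat \<Rightarrow> nat set \<times> ereal list \<times> real"
where
  "md_focus_run C ell H qmin x 0 = ({}, [], 0)"
| "md_focus_run C ell H qmin x (Suc n) =
    (let (T, ms, c) = md_focus_run C ell H qmin x n;
         (T', c') = dyadic_update C qmin x (Suc n) (T, c)
     in (T', Max (glr ell H x (Suc n) ` T') # ms,
         c' + (\<Sum>\<tau>\<in>T'. stat_cost C \<tau> (Suc n) x)))"

definition md_focus_cost ::
  "'v::real_vector cost_model \<Rightarrow> (nat \<Rightarrow> nat \<Rightarrow> 'e \<Rightarrow> 'e \<Rightarrow> (nat \<Rightarrow> 'v) \<Rightarrow> real) \<Rightarrow> ('e \<times> 'e) set \<Rightarrow>
   nat \<Rightarrow> (nat \<Rightarrow> 'v) \<Rightarrow> nat \<Rightarrow> real"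
where
  "md_focus_cost C ell H qmin x n = snd (snd (md_focus_run C ell H qmin x n))"

end

theory Submission
  imports Defs
begin

text \<open>At every moment the index set consists of those indices that are hull vertices of every
  completed dyadic block containing them: dyadic blocks are nested or disjoint, and a vertex of a
  block is a vertex of each smaller block around it. Hence a completed block of length \<open>2 ^ q\<close>
  contributes exactly its hull vertices, whose expected number is at most
  \<open>c1 * ln (2 ^ q + 1) ^ p + c2\<close> since the increments are i.i.d. Cutting \<open>{1..n}\<close> into
  \<open>O(ln n)\<close> dyadic blocks gives an expected index set of size \<open>O(ln n ^ (p + 1))\<close>. The hull call
  at level \<open>q\<close> receives the vertices of two blocks of length \<open>2 ^ (q - 1)\<close>; one factor of its
  quadratic cost is bounded by \<open>2 ^ q\<close>, which is compensated by the \<open>n / 2 ^ q\<close> calls at this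
  level, so that each of the \<open>O(ln n)\<close> levels costs \<open>O(n * ln n ^ p)\<close>.\<close>

subsection \<open>Closed form of the index set\<close>

lemma hull_vertices_subset: "hull_vertices S \<subseteq> S"
  by (auto simp: hull_vertices_def intro: extreme_point_of_convex_hull)

text \<open>A polytope is the hull of its vertices, so discarding non-vertices leaves the hull
  unchanged. Hence earlier pruning inside a block does not distort a later hull call on that
  block.\<close>

lemma hull_vertices_sandwich:
  fixes S :: "'b::euclidean_space set"
  assumes "finite S" "hull_vertices S \<subseteq> U" "U \<subseteq> S"
  shows "hull_vertices U = hull_vertices S"
proof -
  have "convex hull S = convex hull (hull_vertices S)"
    unfolding hull_vertices_def using assms(1) by (rule Krein_Milman_polytope)
  then have "convex hull U = convex hull S"
    using hull_mono[OF assms(2), of convex] hull_mono[OF assms(3), of convex] by auto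
  then show ?thesis by (simp add: hull_vertices_def)
qed

text \<open>Extremality excludes segments inside the hull, and a smaller hull contains fewer
  segments.\<close>

lemma hull_vertices_mono:
  assumes "v \<in> hull_vertices S" "v \<in> U" "U \<subseteq> S"
  shows "v \<in> hull_vertices U"
  using assms hull_mono[OF assms(3), of convex] hull_inc[of v U convex]
  unfolding hull_vertices_def extreme_point_of_def by blast

lemma hull_vertices_translation:
  "hull_vertices ((+) a ` S) = (+) a ` hull_vertices S"
  by (simp add: hull_vertices_def convex_hull_translation extreme_points_of_translation)

lemma inj_P: "inj_on (P x) I"
  by (auto simp: inj_on_def P_def)

definition hull_idx :: "(nat \<Rightarrow> 'v::euclidean_space) \<Rightarrow> nat set \<Rightarrow> nat set" where
  "hull_idx x I = {\<tau> \<in> I. P x \<tau> \<in> hull_vertices (P x ` I)}"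

lemma hull_idx_subset: "hull_idx x I \<subseteq> I"
  by (auto simp: hull_idx_def)

lemma image_hull_idx: "P x ` hull_idx x I = hull_vertices (P x ` I)"
  using hull_vertices_subset[of "P x ` I"] by (auto simp: hull_idx_def)

lemma card_hull_idx: "card (hull_idx x I) = card (hull_vertices (P x ` I))"
  by (metis card_image image_hull_idx inj_P)

lemma hull_idx_sandwich:
  assumes "finite I" "hull_idx x I \<subseteq> J" "J \<subseteq> I"
  shows "hull_idx x J = hull_idx x I"
proof -
  have "hull_vertices (P x ` J) = hull_vertices (P x ` I)"
    using assms by (intro hull_vertices_sandwich) (auto simp flip: image_hull_idx)
  then show ?thesis using assms by (auto simp: hull_idx_def)
qed

lemma hull_idx_mono: "\<tau> \<in> hull_idx x I \<Longrightarrow> \<tau> \<in> J \<Longrightarrow> J \<subseteq> I \<Longrightarrow> \<tau> \<in> hull_idx x J"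
  unfolding hull_idx_def using hull_vertices_mono[of "P x \<tau>" "P x ` I" "P x ` J"] by auto

section \<open>Surviving indices within a time step\<close>

text \<open>The index set while \<open>n\<close> is processed and the loop is about to test level
  \<open>q\<close>. An aligned block constrains its members once its hull call is over: it ends
  before \<open>n\<close>, or it ends at \<open>n\<close> and its level lies below \<open>q\<close>.
  Loop entry is \<open>q = qmin\<close>; \<open>q = n\<close> describes the end of the step, since a
  block of length \<open>2 ^ r\<close> ending at \<open>n\<close> has \<open>r < n\<close>.\<close>

definition candidates ::
  "nat \<Rightarrow> (nat \<Rightarrow> 'v::euclidean_space) \<Rightarrow> nat \<Rightarrow> nat \<Rightarrow> nat set" where
  "candidates qmin x n q = {\<tau> \<in> {1..n}. \<forall>r m. qmin \<le> r \<and> 2 ^ r dvd m \<and> m < \<tau> \<and> \<tau> \<le> m + 2 ^ r \<and>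
     (m + 2 ^ r < n \<or> m + 2 ^ r = n \<and> r < q) \<longrightarrow> \<tau> \<in> hull_idx x {m<..m + 2 ^ r}}"

lemma candidates_subset: "candidates qmin x n q \<subseteq> {1..n}"
  by (auto simp: candidates_def)

lemma finite_candidates [simp]: "finite (candidates qmin x n q)"
  using candidates_subset by (rule finite_subset) simp

lemma candidates_block_subset:
  assumes "qmin \<le> r" "2 ^ r dvd m" "m + 2 ^ r < n \<or> m + 2 ^ r = n \<and> r < q"
  shows "candidates qmin x n q \<inter> {m<..m + 2 ^ r} \<subseteq> hull_idx x {m<..m + 2 ^ r}"
  using assms by (auto simp: candidates_def)

lemma dvd_add_le_of_less:
  fixes a b d :: nat
  assumes "d dvd a" "d dvd b" "a < b"
  shows "a + d \<le> b"
  using assms dvd_imp_le[of d "b - a"] by (auto simp: dvd_diff_nat)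

text \<open>Aligned dyadic blocks are nested or disjoint. A completed block that meets the block of
  length \<open>2 ^ q\<close> ending at \<open>n\<close> cannot be the larger one, so it lies
  inside.\<close>

lemma dyadic_nested:
  fixes n m q r \<tau> :: nat
  assumes "2 ^ q dvd n" "2 ^ q \<le> n" "2 ^ r dvd m" "\<tau> \<le> m + 2 ^ r" "n - 2 ^ q < \<tau>"
    "m + 2 ^ r < n \<or> m + 2 ^ r = n \<and> r < q"
  shows "n - 2 ^ q \<le> m"
proof (cases "r \<le> q")
  case True
  then have "2 ^ r dvd n - 2 ^ q"
    using assms(1) by (meson dvd_diff_nat dvd_trans le_imp_power_dvd)
  then have "n - 2 ^ q + 2 ^ r \<le> m + 2 ^ r"
    using assms by (intro dvd_add_le_of_less) auto
  then show ?thesis by simp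
next
  \<comment> \<open>Here the block ends strictly before \<open>n\<close>, and both ends are
    multiples of \<open>2 ^ q\<close>; it therefore ends at \<open>n - 2 ^ q\<close> or earlier and
    cannot contain \<tau>.\<close>
  case False
  then have "2 ^ q dvd m + 2 ^ r"
    using assms(3) by (meson dvd_add dvd_trans le_imp_power_dvd nat_le_linear)
  then have "m + 2 ^ r + 2 ^ q \<le> n"
    using assms False by (intro dvd_add_le_of_less) auto
  then show ?thesis using assms by linarith
qed

text \<open>The vertices of the full block \<open>B\<close> all survived the smaller blocks, so the
  current set restricted to \<open>B\<close> lies between these vertices and \<open>B\<close>. The
  hull call on the survivors thus finds exactly the vertices of \<open>B\<close>.\<close>

lemma candidates_Suc:
  fixes x :: "nat \<Rightarrow> 'v::euclidean_space"
  assumes "qmin \<le> q" "2 ^ q dvd n" "0 < n"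
  defines "T \<equiv> candidates qmin x n q" and "B \<equiv> {n - 2 ^ q<..n}"
  shows "T - (T \<inter> B - hull_idx x (T \<inter> B)) = candidates qmin x n (Suc q)"
proof -
  have le: "2 ^ q \<le> n" using assms by (auto intro: dvd_imp_le)
  \<comment> \<open>Every completed block through a vertex of \<open>B\<close> is contained in
    \<open>B\<close>, and a vertex remains a vertex in the smaller block.\<close>
  have "hull_idx x B \<subseteq> T"
  proof
    fix \<tau> assume \<tau>: "\<tau> \<in> hull_idx x B"
    then have \<tau>B: "\<tau> \<in> B" using hull_idx_subset by blast
    have "\<tau> \<in> hull_idx x {m<..m + 2 ^ r}"
      if "2 ^ r dvd m" "m < \<tau>" "\<tau> \<le> m + 2 ^ r" "m + 2 ^ r < n \<or> m + 2 ^ r = n \<and> r < q" for r m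
    proof (rule hull_idx_mono[OF \<tau>])
      show "\<tau> \<in> {m<..m + 2 ^ r}" using that by simp
      have "n - 2 ^ q \<le> m"
        using dyadic_nested[OF assms(2) le that(1,3) _ that(4)] \<tau>B by (simp add: B_def)
      then show "{m<..m + 2 ^ r} \<subseteq> B" using that by (auto simp: B_def)
    qed
    moreover have "\<tau> \<in> {1..n}" using \<tau>B by (auto simp: B_def)
    ultimately show "\<tau> \<in> T" by (auto simp: T_def candidates_def)
  qed
  then have "hull_idx x (T \<inter> B) = hull_idx x B"
    using hull_idx_subset[of x B] by (intro hull_idx_sandwich) (auto simp: B_def)
  then have "T - (T \<inter> B - hull_idx x (T \<inter> B)) = {\<tau> \<in> T. \<tau> \<in> B \<longrightarrow> \<tau> \<in> hull_idx x B}"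
    by auto
  also have "\<dots> = candidates qmin x n (Suc q)"
  proof -
    \<comment> \<open>Passing from \<open>q\<close> to \<open>Suc q\<close> adds the condition of a
      single block, namely \<open>B\<close>.\<close>
    have 1: "m + 2 ^ r < n \<or> m + 2 ^ r = n \<and> r < Suc q \<longleftrightarrow>
       (m + 2 ^ r < n \<or> m + 2 ^ r = n \<and> r < q) \<or> r = q \<and> m = n - 2 ^ q" for r m
      using le by (auto simp: less_Suc_eq)
    have 2: "2 ^ q dvd n - 2 ^ q" using assms by (simp add: dvd_diff_nat)
    have 3: "n - 2 ^ q + 2 ^ q = n" using le by simp
    show ?thesis
      unfolding T_def candidates_def 1 B_def using 2 3 assms(1) by (auto 0 3)
  qed
  finally show ?thesis .
qed

text \<open>An aligned block ending at \<open>n\<close> has a length dividing \<open>n\<close>, so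
  none has level \<open>q\<close> or higher. All blocks ending at \<open>n\<close> are then already
  taken into account.\<close>

lemma candidates_saturated:
  assumes "\<not> 2 ^ q dvd n" "0 < n"
  shows "candidates qmin x n q = candidates qmin x n n"
proof -
  have "r < q \<and> r < n" if "2 ^ r dvd m" "m + 2 ^ r = n" for r m
  proof -
    have "2 ^ r dvd n" using that by (metis dvd_add dvd_refl)
    then have "\<not> q \<le> r" using assms(1) by (meson dvd_trans le_imp_power_dvd)
    moreover have "r < n" using that less_exp[of r] by linarith
    ultimately show ?thesis by simp
  qed
  then show ?thesis unfolding candidates_def by (auto 0 3)
qed

lemma finite_dyadic_levels: "0 < n \<Longrightarrow> finite {r. q \<le> r \<and> (2::nat) ^ r dvd n}"
  by (rule finite_subset[of _ "{..n}"])
    (auto dest!: dvd_imp_le intro: order.trans[OF less_imp_le[OF less_exp]])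

text \<open>Divisibility of \<open>n\<close> by powers of two is downward closed in the exponent.
  The levels visited before the first failed test are therefore all levels from \<open>q\<close> on
  that divide \<open>n\<close>, which turns the accumulated cost into a plain sum.\<close>

lemma prune_candidates:
  assumes "0 < n" "qmin \<le> q"
  shows "prune C x n q (candidates qmin x n q, c) = (candidates qmin x n n,
    c + (\<Sum>r | q \<le> r \<and> 2 ^ r dvd n. hull_cost C (P x ` (candidates qmin x n r \<inter> {n - 2 ^ r<..n})) +
      iter_cost C r (candidates qmin x n r)))"
  using assms(2)
proof (induction "n - q" arbitrary: q c rule: less_induct)
  case less
  show ?case
  proof (cases "2 ^ q dvd n")
    case True
    let ?T = "candidates qmin x n q" and ?B = "{n - 2 ^ q<..n}"
    have "2 ^ q \<le> n" using True assms(1) by (auto intro: dvd_imp_le)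
    \<comment> \<open>This makes the induction measure \<open>n - q\<close> drop strictly.\<close>
    then have "q < n" using less_exp[of q] by linarith
    have T': "{\<tau> \<in> ?T. \<tau> > n - 2 ^ q} = ?T \<inter> ?B"
      using candidates_subset[of qmin x n q] by auto
    have lev: "{r. q \<le> r \<and> 2 ^ r dvd n} = insert q {r. Suc q \<le> r \<and> 2 ^ r dvd n}"
      using True by (auto simp: not_less_eq_eq dest: Suc_leI le_neq_implies_less)
    show ?thesis
      unfolding prune.simps[of C x n q] Let_def T'
      unfolding hull_idx_def[symmetric] candidates_Suc[OF less.prems True assms(1)]
      using True assms(1) less.hyps[of "Suc q"] \<open>q < n\<close> less.prems
      by (simp add: lev finite_dyadic_levels algebra_simps)
  next
    case False
    then have none: "{r. q \<le> r \<and> 2 ^ r dvd n} = {}"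
      by (auto dest: power_le_dvd)
    show ?thesis
      using False assms candidates_saturated[OF False, of qmin x]
      by (simp add: prune.simps[of C x n q] none)
  qed
qed

section \<open>Costs of the runs as sums over time steps\<close>

definition round_cost ::
  "'v::euclidean_space cost_model \<Rightarrow> nat \<Rightarrow> (nat \<Rightarrow> 'v) \<Rightarrow> nat \<Rightarrow> real" where
  "round_cost C qmin x n = step_cost C (candidates qmin x n qmin) +
    (\<Sum>r | qmin \<le> r \<and> 2 ^ r dvd n. hull_cost C (P x ` (candidates qmin x n r \<inter> {n - 2 ^ r<..n})) +
      iter_cost C r (candidates qmin x n r))"

text \<open>Both sides impose the blocks ending at \<open>n\<close> or earlier: at loop entry for
  \<open>Suc n\<close> no block ending at \<open>Suc n\<close> counts, as its level would have to be
  below \<open>qmin\<close>. The new index lies in none of these blocks.\<close>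

lemma insert_candidates: "insert (Suc n) (candidates qmin x n n) = candidates qmin x (Suc n) qmin"
proof -
  have "m + 2 ^ r < n \<or> m + 2 ^ r = n \<and> r < n \<longleftrightarrow> m + 2 ^ r < Suc n" for m r :: nat
    by (auto simp: less_Suc_eq intro: order.strict_trans2[OF less_exp])
  then show ?thesis unfolding candidates_def by (auto simp: le_Suc_eq)
qed

lemma dyadic_update_candidates:
  "dyadic_update C qmin x (Suc n) (candidates qmin x n n, c) =
    (candidates qmin x (Suc n) (Suc n), c + round_cost C qmin x (Suc n))"
  by (simp add: dyadic_update_def insert_candidates prune_candidates round_cost_def)

lemma dyadic_run_candidates:
  "dyadic_run C qmin x n = (candidates qmin x n n, \<Sum>k=1..n. round_cost C qmin x k)"
proof (induction n)
  case 0
  show ?case by (simp add: candidates_def)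
next
  case (Suc n)
  then show ?case by (simp add: dyadic_update_candidates)
qed

lemma dyadic_cost_eq: "dyadic_cost C qmin x n = (\<Sum>k=1..n. round_cost C qmin x k)"
  by (simp add: dyadic_cost_def dyadic_run_candidates)

text \<open>The recorded maxima feed back into neither the index set nor the cost, so their list
  stays existential.\<close>

lemma md_focus_run_candidates:
  "\<exists>ms. md_focus_run C ell H qmin x n = (candidates qmin x n n, ms,
    \<Sum>k=1..n. round_cost C qmin x k + (\<Sum>\<tau>\<in>candidates qmin x k k. stat_cost C \<tau> k x))"
proof (induction n)
  case 0
  show ?case by (simp add: candidates_def)
next
  case (Suc n)
  then show ?case by (auto simp: dyadic_update_candidates)
qed

lemma md_focus_cost_eq:
  "md_focus_cost C ell H qmin x n =
    (\<Sum>k=1..n. round_cost C qmin x k + (\<Sum>\<tau>\<in>candidates qmin x k k. stat_cost C \<tau> k x))"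
  using md_focus_run_candidates[of C ell H qmin x n] by (auto simp: md_focus_cost_def)

subsection \<open>Measurability and stationarity\<close>

text \<open>If a vertex lay in the hull of the other points, it would be extreme there too and hence
  be one of them. Together with strict separation this turns extremality into strict linear
  inequalities.\<close>

lemma in_hull_vertices_iff:
  fixes S :: "'b::euclidean_space set"
  assumes "finite S" "v \<in> S"
  shows "v \<in> hull_vertices S \<longleftrightarrow> v \<notin> convex hull (S - {v})"
proof
  assume "v \<in> hull_vertices S"
  then have "v extreme_point_of convex hull S" by (simp add: hull_vertices_def)
  then have "v extreme_point_of convex hull (S - {v})" if "v \<in> convex hull (S - {v})"
    using that hull_mono[of "S - {v}" S convex] by (auto simp: extreme_point_of_def)
  then show "v \<notin> convex hull (S - {v})"
    using extreme_point_of_convex_hull by blast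
next
  assume "v \<notin> convex hull (S - {v})"
  then show "v \<in> hull_vertices S"
    using assms extreme_point_of_convex_hull_insert[of "S - {v}" v]
    by (simp add: hull_vertices_def insert_absorb)
qed

lemma not_in_convex_hull_iff_separated:
  fixes S :: "'b::euclidean_space set"
  assumes "finite S"
  shows "v \<notin> convex hull S \<longleftrightarrow> (\<exists>a. \<forall>z\<in>S. 0 < inner a (z - v))"
proof
  assume "v \<notin> convex hull S"
  then obtain a b where "inner a v < b" "\<forall>z\<in>convex hull S. inner a z > b"
    using separating_hyperplane_closed_point[of "convex hull S" v] assms
    by (auto intro: compact_imp_closed finite_imp_compact_convex_hull)
  then have "\<forall>z\<in>S. 0 < inner a (z - v)"
    by (force simp: inner_diff_right dest: hull_inc[of _ S convex])
  then show "\<exists>a. \<forall>z\<in>S. 0 < inner a (z - v)" by blast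
next
  assume "\<exists>a. \<forall>z\<in>S. 0 < inner a (z - v)"
  then obtain a where "S \<subseteq> {z. inner a z > inner a v}"
    by (auto simp: inner_diff_right)
  then have "convex hull S \<subseteq> {z. inner a z > inner a v}"
    by (intro hull_minimal convex_halfspace_gt)
  then show "v \<notin> convex hull S" by auto
qed

lemma measurable_P [measurable]:
  fixes y :: "nat \<Rightarrow> 'a \<Rightarrow> 'v::euclidean_space"
  assumes "\<And>t. 1 \<le> t \<Longrightarrow> t \<le> \<tau> \<Longrightarrow> y t \<in> borel_measurable N"
  shows "(\<lambda>\<omega>. P (\<lambda>t. y t \<omega>) \<tau>) \<in> borel_measurable N"
  unfolding P_def using assms by (intro borel_measurable_Pair borel_measurable_sum) auto

text \<open>The existence of a separating normal can be tested on a countable dense set of normals,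
  each test being finitely many measurable strict inequalities. The general process \<open>y\<close>
  covers both the data and the coordinates of a finite product space, where only the times
  \<open>1\<close> to \<open>n\<close> are available.\<close>

lemma pred_hull_idx:
  fixes y :: "nat \<Rightarrow> 'a \<Rightarrow> 'v::euclidean_space"
  assumes y: "\<And>t. 1 \<le> t \<Longrightarrow> t \<le> n \<Longrightarrow> y t \<in> borel_measurable N" and I: "I \<subseteq> {..n}"
  shows "Measurable.pred N (\<lambda>\<omega>. \<tau> \<in> hull_idx (\<lambda>t. y t \<omega>) I)"
proof (cases "\<tau> \<in> I")
  case True
  have fin: "finite I" using I finite_subset by blast
  have P: "(\<lambda>\<omega>. P (\<lambda>t. y t \<omega>) i) \<in> borel_measurable N" if "i \<in> I" for i
    using that I y by (intro measurable_P) auto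
  obtain D :: "(real \<times> 'v) set" where D: "countable D" "\<And>X. open X \<Longrightarrow> X \<noteq> {} \<Longrightarrow> \<exists>d\<in>D. d \<in> X"
    using countable_dense_setE by blast
  have "\<tau> \<in> hull_idx x I \<longleftrightarrow> (\<exists>a\<in>D. \<forall>i\<in>I - {\<tau>}. 0 < inner a (P x i - P x \<tau>))" for x :: "nat \<Rightarrow> 'v"
  proof -
    have "\<tau> \<in> hull_idx x I \<longleftrightarrow> P x \<tau> \<notin> convex hull (P x ` I - {P x \<tau>})"
      using True fin by (simp add: hull_idx_def in_hull_vertices_iff)
    also have "P x ` I - {P x \<tau>} = P x ` (I - {\<tau>})"
      by (auto simp: P_def)
    also have "P x \<tau> \<notin> convex hull \<dots> \<longleftrightarrow> (\<exists>a. \<forall>i\<in>I - {\<tau>}. 0 < inner a (P x i - P x \<tau>))"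
      using fin by (subst not_in_convex_hull_iff_separated) auto
    also have "\<dots> \<longleftrightarrow> (\<exists>a\<in>D. \<forall>i\<in>I - {\<tau>}. 0 < inner a (P x i - P x \<tau>))"
    proof -
      \<comment> \<open>The separating normals form a finite intersection of open halfspaces, so
        this set meets \<open>D\<close> as soon as it is nonempty.\<close>
      have "{a. \<forall>i\<in>I - {\<tau>}. 0 < inner a (P x i - P x \<tau>)} =
          (\<Inter>i\<in>I - {\<tau>}. {a. 0 < inner (P x i - P x \<tau>) a})"
        by (auto simp: inner_commute)
      also have "open \<dots>"
        using fin by (intro open_INT ballI open_halfspace_gt) auto
      finally show ?thesis using D(2) by blast
    qed
    finally show ?thesis .
  qed
  moreover have "Measurable.pred N (\<lambda>\<omega>. \<exists>a\<in>D. \<forall>i\<in>I - {\<tau>}.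
      0 < inner a (P (\<lambda>t. y t \<omega>) i - P (\<lambda>t. y t \<omega>) \<tau>))" (is "Measurable.pred N (\<lambda>\<omega>. \<exists>a\<in>D. ?Q a \<omega>)")
  proof -
    have "Measurable.pred N (?Q a)" for a
      using fin P True
      by (intro pred_intros_finite(3) borel_measurable_pred_less borel_measurable_inner
          borel_measurable_diff borel_measurable_const) auto
    then have "(\<Union>a\<in>D. {\<omega> \<in> space N. ?Q a \<omega>}) \<in> sets N"
      using D(1) by (intro sets.countable_UN' predE) auto
    also have "(\<Union>a\<in>D. {\<omega> \<in> space N. ?Q a \<omega>}) = {\<omega> \<in> space N. \<exists>a\<in>D. ?Q a \<omega>}"
      by blast
    finally show ?thesis by (simp add: pred_def)
  qed
  ultimately show ?thesis by simp
next
  case False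
  then show ?thesis by (simp add: hull_idx_def)
qed

lemma pred_candidates:
  fixes y :: "nat \<Rightarrow> 'a \<Rightarrow> 'v::euclidean_space"
  assumes "\<And>t. 1 \<le> t \<Longrightarrow> y t \<in> borel_measurable N"
  shows "Measurable.pred N (\<lambda>\<omega>. \<tau> \<in> candidates qmin (\<lambda>t. y t \<omega>) n q)"
proof -
  have [measurable]: "Measurable.pred N (\<lambda>\<omega>. \<tau> \<in> hull_idx (\<lambda>t. y t \<omega>) {m<..m + 2 ^ r})" for m r
    using assms by (rule pred_hull_idx) auto
  show ?thesis
    unfolding candidates_def mem_Collect_eq by measurable
qed

text \<open>A random subset of a finite set takes finitely many values, and each value is attained
  on a finite conjunction of membership events. This reduces costs evaluated on the random index set
  to costs on fixed sets.\<close>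

lemma measurable_random_finite_set:
  assumes T: "\<And>\<omega>. \<omega> \<in> space N \<Longrightarrow> T \<omega> \<subseteq> A" and "finite A"
    and pred: "\<And>a. a \<in> A \<Longrightarrow> Measurable.pred N (\<lambda>\<omega>. a \<in> T \<omega>)"
    and f: "\<And>I. I \<subseteq> A \<Longrightarrow> f I \<in> measurable N K"
  shows "(\<lambda>\<omega>. f (T \<omega>) \<omega>) \<in> measurable N K"
proof (rule measurable_compose_countable'[where f = f and g = T and I = "Pow A"])
  show "T \<in> measurable N (count_space (Pow A))"
  proof -
    have "T -` {I} \<inter> space N = {\<omega> \<in> space N. \<forall>a\<in>A. (a \<in> T \<omega>) = (a \<in> I)}" if "I \<subseteq> A" for I
      using that T by blast
    moreover have "Measurable.pred N (\<lambda>\<omega>. \<forall>a\<in>A. (a \<in> T \<omega>) = (a \<in> I))" for I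
      using \<open>finite A\<close> pred by (intro pred_intros_finite(3) pred_intros_logic(6)) simp_all
    ultimately have "T -` {I} \<inter> space N \<in> sets N" if "I \<subseteq> A" for I
      using that by (simp add: pred_def)
    then show ?thesis
      using T \<open>finite A\<close> by (simp add: measurable_count_space_eq2 Pi_iff)
  qed
qed (use f \<open>finite A\<close> in \<open>auto intro: countable_finite\<close>)

lemma measurable_card_hull_idx:
  fixes y :: "nat \<Rightarrow> 'a \<Rightarrow> 'v::euclidean_space"
  assumes "\<And>t. 1 \<le> t \<Longrightarrow> t \<le> n \<Longrightarrow> y t \<in> borel_measurable N" and "I \<subseteq> {..n}"
  shows "(\<lambda>\<omega>. real (card (hull_idx (\<lambda>t. y t \<omega>) I))) \<in> borel_measurable N"
proof (rule measurable_random_finite_set[where f = "\<lambda>J \<omega>. real (card J)"])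
  show "hull_idx (\<lambda>t. y t \<omega>) I \<subseteq> I" for \<omega> by (rule hull_idx_subset)
  show "finite I" using assms(2) by (rule finite_subset) simp
  show "Measurable.pred N (\<lambda>\<omega>. a \<in> hull_idx (\<lambda>t. y t \<omega>) I)" for a
    using assms by (rule pred_hull_idx)
qed simp

section \<open>Invariance of vertex counts under time shifts\<close>

text \<open>Restarting the path after \<open>m\<close> translates its points by
  \<open>P x m\<close>, and translation preserves vertices. The argument \<open>k + 1\<close>
  appears because \<open>num_vertices\<close> at \<open>n\<close> uses the points \<open>1\<close>
  to \<open>n - 1\<close>.\<close>

lemma card_hull_idx_shift:
  "card (hull_idx x {m<..m + k}) = num_vertices (\<lambda>t. x (m + t)) (k + 1)"
proof -
  have "P x (m + i) = P x m + P (\<lambda>t. x (m + t)) i" for i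
  proof -
    have "(\<Sum>t=1..m + i. x t) = (\<Sum>t=1..m. x t) + (\<Sum>t=m+1..m + i. x t)"
      by (rule sum.ub_add_nat) simp
    also have "(\<Sum>t=m+1..m + i. x t) = (\<Sum>t=1..i. x (m + t))"
      by (rule sum.reindex_bij_witness[of _ "\<lambda>t. m + t" "\<lambda>t. t - m"]) auto
    finally show ?thesis by (simp add: P_def)
  qed
  moreover have "{m<..m + k} = (+) m ` {1..k}"
    by (simp add: image_add_atLeastAtMost atLeastSucAtMost_greaterThanAtMost)
  ultimately have "P x ` {m<..m + k} = (+) (P x m) ` P (\<lambda>t. x (m + t)) ` {1..k}"
    by (simp only: image_image)
  then show ?thesis
    by (simp add: card_hull_idx num_vertices_def hull_vertices_translation card_image)
qed

lemma num_vertices_cong: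
  assumes "\<And>t. 1 \<le> t \<Longrightarrow> t < n \<Longrightarrow> x t = y t"
  shows "num_vertices x n = num_vertices y n"
proof -
  have "P x \<tau> = P y \<tau>" if "\<tau> \<in> {1..n - 1}" for \<tau>
    using that assms by (auto simp: P_def intro!: sum.cong)
  then have "P x ` {1..n - 1} = P y ` {1..n - 1}" by (intro image_cong) auto
  then show ?thesis by (simp add: num_vertices_def)
qed

lemma num_vertices_eq_card_hull_idx: "num_vertices x n = card (hull_idx x {1..n - 1})"
  by (simp add: num_vertices_def card_hull_idx)

context prob_space
begin

text \<open>Independence makes the joint law of a window of increments a product, identical
  marginals make it a power of the law of \<open>x 1\<close>, and reindexing by \<open>m\<close>
  preserves that power.\<close>

lemma distr_iid_shift:
  assumes indep: "indep_vars (\<lambda>_. N) x {1..}"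
    and ident: "\<And>t. t \<ge> 1 \<Longrightarrow> distr M N (x t) = distr M N (x 1)"
    and "1 \<le> k"
  shows "distr M (\<Pi>\<^sub>M i\<in>{1..k}. N) (\<lambda>\<omega>. \<lambda>i\<in>{1..k}. x (m + i) \<omega>) =
    (\<Pi>\<^sub>M i\<in>{1..k::nat}. distr M N (x 1))"
proof -
  let ?J = "{m + 1..m + k}" and ?\<mu> = "distr M N (x 1)"
  have rv: "random_variable N (x t)" if "t \<ge> 1" for t
    using indep that by (auto simp: indep_vars_def)
  have "indep_vars (\<lambda>_. N) x ?J"
    by (rule indep_vars_subset[OF indep]) auto
  then have "distr M (\<Pi>\<^sub>M i\<in>?J. N) (\<lambda>\<omega>. \<lambda>i\<in>?J. x i \<omega>) = (\<Pi>\<^sub>M i\<in>?J. distr M N (x i))"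
    using rv \<open>1 \<le> k\<close> by (subst (asm) indep_vars_iff_distr_eq_PiM') auto
  also have "\<dots> = (\<Pi>\<^sub>M i\<in>?J. ?\<mu>)"
    by (intro PiM_cong ident) auto
  finally have J: "distr M (\<Pi>\<^sub>M i\<in>?J. N) (\<lambda>\<omega>. \<lambda>i\<in>?J. x i \<omega>) = (\<Pi>\<^sub>M i\<in>?J. ?\<mu>)" .
  have "(\<Pi>\<^sub>M i\<in>{1..k}. ?\<mu>) =
      distr (\<Pi>\<^sub>M i\<in>?J. ?\<mu>) (\<Pi>\<^sub>M i\<in>{1..k}. ?\<mu>) (\<lambda>\<omega>. \<lambda>n\<in>{1..k}. \<omega> (m + n))"
    using rv by (intro distr_PiM_reindex[symmetric] prob_space_distr) auto
  also have "\<dots> = distr (\<Pi>\<^sub>M i\<in>?J. ?\<mu>) (\<Pi>\<^sub>M i\<in>{1..k}. N) (\<lambda>\<omega>. \<lambda>n\<in>{1..k}. \<omega> (m + n))"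
    by (intro distr_cong sets_PiM_cong) auto
  also have "\<dots> = distr M (\<Pi>\<^sub>M i\<in>{1..k}. N)
      ((\<lambda>\<omega>. \<lambda>n\<in>{1..k}. \<omega> (m + n)) \<circ> (\<lambda>\<omega>. \<lambda>i\<in>?J. x i \<omega>))"
    unfolding J[symmetric] using rv
    by (intro distr_distr measurable_restrict measurable_component_singleton) auto
  also have "(\<lambda>\<omega>. \<lambda>n\<in>{1..k}. \<omega> (m + n)) \<circ> (\<lambda>\<omega>. \<lambda>i\<in>?J. x i \<omega>) =
      (\<lambda>\<omega>. \<lambda>i\<in>{1..k}. x (m + i) \<omega>)"
    by (auto simp: fun_eq_iff)
  finally show ?thesis ..
qed

lemma expectation_card_hull_idx_shift:
  fixes x :: "nat \<Rightarrow> 'a \<Rightarrow> 'v::euclidean_space"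
  assumes indep: "indep_vars (\<lambda>_. borel) x {1..}"
    and ident: "\<And>t. t \<ge> 1 \<Longrightarrow> distr M borel (x t) = distr M borel (x 1)"
    and "1 \<le> k"
  shows "expectation (\<lambda>\<omega>. real (card (hull_idx (\<lambda>t. x t \<omega>) {m<..m + k}))) =
    expectation (\<lambda>\<omega>. real (num_vertices (\<lambda>t. x t \<omega>) (k + 1)))"
proof -
  let ?F = "\<lambda>y :: nat \<Rightarrow> 'v. real (num_vertices y (k + 1))"
  let ?X = "\<lambda>m \<omega>. \<lambda>i\<in>{1..k}. x (m + i) \<omega>"
  let ?PM = "\<Pi>\<^sub>M i\<in>{1..k}. borel :: 'v measure"
  have rv: "random_variable borel (x t)" if "t \<ge> 1" for t
    using indep that by (auto simp: indep_vars_def)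
  have F: "?F \<in> borel_measurable ?PM"
    unfolding num_vertices_eq_card_hull_idx
    by (rule measurable_card_hull_idx[where n = k and y = "\<lambda>t \<omega>. \<omega> t"])
      (auto intro!: measurable_component_singleton)
  have X: "?X m \<in> measurable M ?PM" for m
    using rv by (intro measurable_restrict) auto
  \<comment> \<open>Outside \<open>{1..k}\<close> the restricted sequence is
    \<open>undefined\<close>, but \<open>num_vertices\<close> at \<open>k + 1\<close> reads only the
    coordinates \<open>1\<close> to \<open>k\<close>.\<close>
  have "expectation (\<lambda>\<omega>. ?F (\<lambda>t. x (m + t) \<omega>)) = integral\<^sup>L (distr M ?PM (?X m)) ?F" for m
    unfolding integral_distr[OF X F]
    by (intro Bochner_Integration.integral_cong refl arg_cong[of _ _ real] num_vertices_cong) auto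
  moreover have "distr M ?PM (?X m) = distr M ?PM (?X 0)"
    using distr_iid_shift[OF indep ident \<open>1 \<le> k\<close>, of m]
      distr_iid_shift[OF indep ident \<open>1 \<le> k\<close>, of 0] by simp
  ultimately have "expectation (\<lambda>\<omega>. ?F (\<lambda>t. x (m + t) \<omega>)) = expectation (\<lambda>\<omega>. ?F (\<lambda>t. x (0 + t) \<omega>))"
    by presburger
  then show ?thesis by (simp add: card_hull_idx_shift)
qed

end

subsection \<open>Dyadic counting\<close>

lemma card_multiples_le:
  fixes n d :: nat
  assumes "0 < d"
  shows "real (card {k \<in> {1..n}. d dvd k}) \<le> real n / real d"
proof -
  have "{k \<in> {1..n}. d dvd k} \<subseteq> (*) d ` {1..n div d}"
    using assms by (auto elim!: dvdE simp: less_eq_div_iff_mult_less_eq mult.commute Suc_le_eq)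
  then have "card {k \<in> {1..n}. d dvd k} \<le> card {1..n div d}"
    using surj_card_le[of "{1..n div d}" "{k \<in> {1..n}. d dvd k}" "(*) d"] by simp
  then have "real (card {k \<in> {1..n}. d dvd k}) \<le> real (n div d)" by simp
  also have "\<dots> \<le> real n / real d" by (rule of_nat_div_le_of_nat)
  finally show ?thesis .
qed

text \<open>Exchanging the sums counts, for each level \<open>r\<close>, the multiples of
  \<open>2 ^ r\<close> up to \<open>n\<close>, of which there are at most \<open>n / 2 ^ r\<close>.
  Levels above \<open>L\<close> never occur, since \<open>2 ^ r\<close> would exceed
  \<open>n\<close>.\<close>

lemma sum_dyadic_levels_le:
  fixes h :: "nat \<Rightarrow> real"
  assumes h: "\<And>r. 0 \<le> h r" and "n < 2 ^ (L + 1)"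
  shows "(\<Sum>k=1..n. \<Sum>r | q \<le> r \<and> 2 ^ r dvd k. h r) \<le> (\<Sum>r\<le>L. real n / 2 ^ r * h r)"
proof -
  have "(\<Sum>r | q \<le> r \<and> 2 ^ r dvd k. h r) \<le> (\<Sum>r\<le>L. if 2 ^ r dvd k then h r else 0)"
    if "k \<in> {1..n}" for k
  proof -
    have "r \<le> L" if "2 ^ r dvd k" for r
    proof -
      have "(2::nat) ^ r \<le> k" using that \<open>k \<in> {1..n}\<close> by (auto intro: dvd_imp_le)
      also have "\<dots> < 2 ^ (L + 1)" using assms(2) \<open>k \<in> {1..n}\<close> by simp
      finally have "r < L + 1" by (rule power_less_imp_less_exp[rotated]) simp
      then show "r \<le> L" by simp
    qed
    then have "(\<Sum>r | q \<le> r \<and> 2 ^ r dvd k. h r) \<le> (\<Sum>r | r \<in> {..L} \<and> 2 ^ r dvd k. h r)"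
      using h by (intro sum_mono2) auto
    also have "\<dots> = (\<Sum>r\<le>L. if 2 ^ r dvd k then h r else 0)"
      by (rule sum.inter_filter) simp
    finally show ?thesis .
  qed
  then have "(\<Sum>k=1..n. \<Sum>r | q \<le> r \<and> 2 ^ r dvd k. h r) \<le>
      (\<Sum>k=1..n. \<Sum>r\<le>L. if 2 ^ r dvd k then h r else 0)"
    by (rule sum_mono)
  also have "\<dots> = (\<Sum>r\<le>L. \<Sum>k=1..n. if 2 ^ r dvd k then h r else 0)"
    by (rule sum.swap)
  also have "\<dots> = (\<Sum>r\<le>L. real (card {k \<in> {1..n}. 2 ^ r dvd k}) * h r)"
    by (intro sum.cong refl) (simp add: sum.inter_filter[symmetric])
  also have "\<dots> \<le> (\<Sum>r\<le>L. real n / 2 ^ r * h r)"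
  proof (intro sum_mono mult_right_mono h)
    show "real (card {k \<in> {1..n}. 2 ^ r dvd k}) \<le> real n / 2 ^ r" for r
      using card_multiples_le[of "2 ^ r" n] by simp
  qed
  finally show ?thesis .
qed

lemma sum_inverse_powers_2_le: "(\<Sum>r\<le>L. 1 / 2 ^ r :: real) \<le> 2"
proof -
  have "(\<Sum>r\<le>L. 1 / 2 ^ r :: real) = 2 - 1 / 2 ^ L"
    by (induction L) (auto simp: field_simps)
  then show ?thesis by simp
qed

section \<open>Cutting an initial segment into dyadic blocks\<close>

text \<open>The number \<open>k div 2 ^ r * 2 ^ r\<close> is \<open>k\<close> with its lowest
  \<open>r\<close> binary digits cleared. Clearing one digit after the other cuts
  \<open>{1..k}\<close> into pieces; the fewer than \<open>2 ^ qmin\<close> indices beyond the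
  coarsest start are counted trivially.\<close>

lemma card_dyadic_decomposition:
  fixes T :: "nat set"
  assumes "T \<subseteq> {1..k}" "k < 2 ^ (qmin + N)"
  shows "card T \<le> 2 ^ qmin +
    (\<Sum>r=qmin..<qmin + N. card (T \<inter> {k div 2 ^ Suc r * 2 ^ Suc r<..k div 2 ^ r * 2 ^ r}))"
proof -
  have fin: "finite T" using assms(1) finite_subset by blast
  \<comment> \<open>The induction carries the part not yet cut off as a last term; it becomes empty
    once all digits of \<open>k\<close> are cleared.\<close>
  have "card T \<le> 2 ^ qmin +
      (\<Sum>r=qmin..<qmin + N. card (T \<inter> {k div 2 ^ Suc r * 2 ^ Suc r<..k div 2 ^ r * 2 ^ r})) +
      card (T \<inter> {0<..k div 2 ^ (qmin + N) * 2 ^ (qmin + N)})" for N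
  proof (induction N)
    case 0
    let ?a = "k div 2 ^ qmin * 2 ^ qmin"
    have "T \<subseteq> {?a<..k} \<union> (T \<inter> {0<..?a})" using assms(1) by auto
    then have "card T \<le> card {?a<..k} + card (T \<inter> {0<..?a})"
      using fin by (intro order.trans[OF card_mono card_Un_le]) auto
    also have "card {?a<..k} = k mod 2 ^ qmin"
      by (simp add: minus_div_mult_eq_mod)
    also have "\<dots> \<le> 2 ^ qmin" by (simp add: less_imp_le)
    finally show ?case by simp
  next
    case (Suc N)
    let ?a = "\<lambda>r. k div 2 ^ r * 2 ^ r"
    have "T \<inter> {0<..?a (qmin + N)} \<subseteq> (T \<inter> {?a (Suc (qmin + N))<..?a (qmin + N)}) \<union> (T \<inter> {0<..?a (Suc (qmin + N))})"
      by auto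
    then have "card (T \<inter> {0<..?a (qmin + N)}) \<le>
        card (T \<inter> {?a (Suc (qmin + N))<..?a (qmin + N)}) + card (T \<inter> {0<..?a (Suc (qmin + N))})"
      using fin by (intro order.trans[OF card_mono card_Un_le]) auto
    then show ?case using Suc.IH by simp
  qed
  from this[of N] show ?thesis using assms(2) by simp
qed

text \<open>The two cases are the values 0 and 1 of binary digit \<open>r\<close> of
  \<open>k\<close>, which is the parity of \<open>k div 2 ^ r\<close>: the piece is empty or one
  aligned block.\<close>

lemma dyadic_interval_cases:
  fixes k r :: nat
  defines "m \<equiv> k div 2 ^ Suc r * 2 ^ Suc r"
  shows "k div 2 ^ r * 2 ^ r = m \<or> k div 2 ^ r * 2 ^ r = m + 2 ^ r \<and> 2 ^ r dvd m \<and> m + 2 ^ r \<le> k"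
proof -
  define a where "a = k div 2 ^ r"
  have "k div 2 ^ Suc r = a div 2"
    by (simp only: a_def power_Suc2 div_mult2_eq)
  then have m: "m = a div 2 * 2 * 2 ^ r" by (simp add: m_def)
  have "a * 2 ^ r \<le> k" unfolding a_def by (rule div_times_less_eq_dividend)
  moreover have "a * 2 ^ r = m \<or> a * 2 ^ r = m + 2 ^ r"
  proof (cases "even a")
    case False
    then have "a = a div 2 * 2 + 1" by presburger
    then have "a * 2 ^ r = (a div 2 * 2 + 1) * 2 ^ r" by presburger
    then show ?thesis by (simp add: m)
  qed (simp add: m)
  moreover have "2 ^ r dvd m" by (simp add: m)
  ultimately show ?thesis unfolding a_def[symmetric] by auto
qed

lemma candidates_antimono: "q \<le> q' \<Longrightarrow> candidates qmin x n q' \<subseteq> candidates qmin x n q"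
  unfolding candidates_def by (auto 0 3)

lemma card_candidates_le: "card (candidates qmin x n q \<inter> B) \<le> n"
proof -
  have "card (candidates qmin x n q \<inter> B) \<le> card {1..n}"
    by (intro card_mono le_infI1 candidates_subset finite_atLeastAtMost)
  then show ?thesis by simp
qed

text \<open>After the insertion of the new index a time step only removes indices. Intermediate sets
  are thus controlled by the final set of the preceding step.\<close>

lemma card_candidates_Suc_le:
  assumes "qmin \<le> q"
  shows "card (candidates qmin x (Suc n) q) \<le> 1 + card (candidates qmin x n n)"
proof -
  have "card (candidates qmin x (Suc n) q) \<le> card (insert (Suc n) (candidates qmin x n n))"
    unfolding insert_candidates by (intro card_mono candidates_antimono assms) simp
  also have "\<dots> \<le> 1 + card (candidates qmin x n n)"
    by (simp add: card_insert_if)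
  finally show ?thesis .
qed

subsection \<open>Expected sizes\<close>

locale dyadic_walk = prob_space M for M :: "'a measure" +
  fixes x :: "nat \<Rightarrow> 'a \<Rightarrow> 'v::euclidean_space" and qmin p :: nat and c1 c2 :: real
  assumes indep: "indep_vars (\<lambda>_. borel) x {1..}"
    and ident: "\<And>t. t \<ge> 1 \<Longrightarrow> distr M borel (x t) = distr M borel (x 1)"
    and c1: "0 \<le> c1" and c2: "0 \<le> c2"
    and vertices: "\<And>n. n \<ge> 1 \<Longrightarrow>
      expectation (\<lambda>\<omega>. real (num_vertices (\<lambda>t. x t \<omega>) n)) \<le> c1 * ln (real n) ^ p + c2"
begin

abbreviation cand :: "nat \<Rightarrow> nat \<Rightarrow> 'a \<Rightarrow> nat set" where
  "cand k q \<omega> \<equiv> candidates qmin (\<lambda>t. x t \<omega>) k q"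

text \<open>A block of \<open>2 ^ r\<close> points corresponds to \<open>num_vertices\<close> at
  \<open>2 ^ r + 1\<close>, hence the shift by one. By monotonicity a single value at
  \<open>n\<close> serves all blocks of length at most \<open>n\<close>.\<close>

definition vertex_bound :: "nat \<Rightarrow> real" where
  "vertex_bound n = c1 * ln (real n + 1) ^ p + c2"

lemma vertex_bound_nonneg: "0 \<le> vertex_bound n"
  using c1 c2 by (simp add: vertex_bound_def)

lemma measurable_x: "1 \<le> t \<Longrightarrow> x t \<in> borel_measurable M"
  using indep by (auto simp: indep_vars_def)

lemma measurable_cand:
  assumes "\<And>I. I \<subseteq> {1..k} \<Longrightarrow> f I \<in> measurable M K"
  shows "(\<lambda>\<omega>. f (cand k q \<omega>) \<omega>) \<in> measurable M K"
proof (rule measurable_random_finite_set)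
  show "cand k q \<omega> \<subseteq> {1..k}" for \<omega> by (rule candidates_subset)
  show "Measurable.pred M (\<lambda>\<omega>. \<tau> \<in> cand k q \<omega>)" for \<tau>
    using measurable_x by (rule pred_candidates)
qed (use assms in simp_all)

lemma integrable_card_hull_idx:
  "integrable M (\<lambda>\<omega>. real (card (hull_idx (\<lambda>t. x t \<omega>) {m<..m + k})))"
proof (rule integrable_const_bound)
  have "card (hull_idx (\<lambda>t. x t \<omega>) {m<..m + k}) \<le> k" for \<omega>
    using card_mono[OF _ hull_idx_subset, of "{m<..m + k}"] by simp
  then show "AE \<omega> in M. norm (real (card (hull_idx (\<lambda>t. x t \<omega>) {m<..m + k}))) \<le> real k"
    by simp
  show "(\<lambda>\<omega>. real (card (hull_idx (\<lambda>t. x t \<omega>) {m<..m + k}))) \<in> borel_measurable M"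
    by (rule measurable_card_hull_idx[where n = "m + k"]) (use measurable_x in auto)
qed

lemma integrable_card_cand_Int: "integrable M (\<lambda>\<omega>. real (card (cand k q \<omega> \<inter> B)))"
proof (rule integrable_const_bound)
  show "AE \<omega> in M. norm (real (card (cand k q \<omega> \<inter> B))) \<le> real k"
    by (simp add: card_candidates_le)
  show "(\<lambda>\<omega>. real (card (cand k q \<omega> \<inter> B))) \<in> borel_measurable M"
    by (rule measurable_cand[where f = "\<lambda>I \<omega>. real (card (I \<inter> B))"]) simp
qed

lemma integrable_card_cand: "integrable M (\<lambda>\<omega>. real (card (cand k q \<omega>)))"
  using integrable_card_cand_Int[of k q UNIV] by simp

section \<open>Expectation bounds for blocks, index sets and hull inputs\<close>

lemma expectation_hull_idx_le:
  assumes "2 ^ r \<le> n"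
  shows "expectation (\<lambda>\<omega>. real (card (hull_idx (\<lambda>t. x t \<omega>) {m<..m + 2 ^ r}))) \<le> vertex_bound n"
proof -
  have "expectation (\<lambda>\<omega>. real (card (hull_idx (\<lambda>t. x t \<omega>) {m<..m + 2 ^ r}))) =
      expectation (\<lambda>\<omega>. real (num_vertices (\<lambda>t. x t \<omega>) (2 ^ r + 1)))"
    using indep ident by (rule expectation_card_hull_idx_shift) simp_all
  also have "\<dots> \<le> c1 * ln (real (2 ^ r + 1)) ^ p + c2"
    by (rule vertices) simp
  also have "\<dots> \<le> vertex_bound n"
  proof -
    have "real (2 ^ r + 1) \<le> real n + 1" using assms of_nat_mono[OF assms] by simp
    then have "ln (real (2 ^ r + 1)) \<le> ln (real n + 1)" by (subst ln_le_cancel_iff) (auto intro: add_pos_pos)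
    then show ?thesis
      unfolding vertex_bound_def using c1 by (intro add_right_mono mult_left_mono power_mono) auto
  qed
  finally show ?thesis .
qed

lemma expectation_cand_block_le:
  assumes "qmin \<le> r" "2 ^ r dvd m" "m + 2 ^ r < k \<or> m + 2 ^ r = k \<and> r < q" "k \<le> n"
  shows "expectation (\<lambda>\<omega>. real (card (cand k q \<omega> \<inter> {m<..m + 2 ^ r}))) \<le> vertex_bound n"
proof -
  have "card (cand k q \<omega> \<inter> {m<..m + 2 ^ r}) \<le> card (hull_idx (\<lambda>t. x t \<omega>) {m<..m + 2 ^ r})" for \<omega>
    by (intro card_mono candidates_block_subset[OF assms(1-3)] finite_subset[OF hull_idx_subset]) simp
  then have "expectation (\<lambda>\<omega>. real (card (cand k q \<omega> \<inter> {m<..m + 2 ^ r}))) \<le>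
      expectation (\<lambda>\<omega>. real (card (hull_idx (\<lambda>t. x t \<omega>) {m<..m + 2 ^ r})))"
    by (intro integral_mono integrable_card_cand_Int integrable_card_hull_idx) simp
  also have "\<dots> \<le> vertex_bound n"
    using assms by (intro expectation_hull_idx_le) auto
  finally show ?thesis .
qed

lemma expectation_card_cand_le:
  assumes "k \<le> n" "n < 2 ^ (L + 1)"
  shows "expectation (\<lambda>\<omega>. real (card (cand k k \<omega>))) \<le> 2 ^ qmin + (real L + 1) * vertex_bound n"
proof -
  let ?R = "{qmin..<qmin + (L + 1)}"
  let ?B = "\<lambda>r. {k div 2 ^ Suc r * 2 ^ Suc r<..k div 2 ^ r * 2 ^ r}"
  \<comment> \<open>The range \<open>?R\<close> has \<open>L + 1\<close> levels, which suffice to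
    clear all digits of \<open>k\<close>; this produces the factor
    \<open>real L + 1\<close>.\<close>
  have "(2::nat) ^ (L + 1) \<le> 2 ^ (qmin + (L + 1))" by (rule power_increasing) auto
  then have k: "k < 2 ^ (qmin + (L + 1))" using assms by linarith
  have "expectation (\<lambda>\<omega>. real (card (cand k k \<omega>))) \<le>
      expectation (\<lambda>\<omega>. 2 ^ qmin + (\<Sum>r\<in>?R. real (card (cand k k \<omega> \<inter> ?B r))))"
  proof (intro integral_mono integrable_card_cand Bochner_Integration.integrable_add
      Bochner_Integration.integrable_sum integrable_card_cand_Int integrable_const)
    fix \<omega>
    show "real (card (cand k k \<omega>)) \<le> 2 ^ qmin + (\<Sum>r\<in>?R. real (card (cand k k \<omega> \<inter> ?B r)))"
      using of_nat_mono[OF card_dyadic_decomposition[OF candidates_subset k], where 'a = real]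
      unfolding of_nat_add of_nat_sum of_nat_power of_nat_numeral .
  qed
  also have "\<dots> = 2 ^ qmin + (\<Sum>r\<in>?R. expectation (\<lambda>\<omega>. real (card (cand k k \<omega> \<inter> ?B r))))"
    by (subst Bochner_Integration.integral_add)
      (simp_all add: integrable_card_cand_Int prob_space del: power_Suc)
  also have "\<dots> \<le> 2 ^ qmin + (\<Sum>r\<in>?R. vertex_bound n)"
  proof (intro add_left_mono sum_mono)
    fix r assume r: "r \<in> ?R"
    define m where "m = k div 2 ^ Suc r * 2 ^ Suc r"
    consider "k div 2 ^ r * 2 ^ r = m"
      | "k div 2 ^ r * 2 ^ r = m + 2 ^ r" "2 ^ r dvd m" "m + 2 ^ r \<le> k"
      using dyadic_interval_cases[of k r] by (auto simp: m_def simp del: power_Suc)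
    then show "expectation (\<lambda>\<omega>. real (card (cand k k \<omega> \<inter> ?B r))) \<le> vertex_bound n"
    proof cases
      case 1
      then show ?thesis unfolding m_def[symmetric] by (simp add: vertex_bound_nonneg)
    next
      case 2
      \<comment> \<open>Needed when the block ends at \<open>k\<close> itself, which counts as
        completed only for levels below \<open>k\<close>.\<close>
      have "r < k" using 2(3) less_exp[of r] by linarith
      then show ?thesis
        unfolding m_def[symmetric] 2(1) using r 2 assms
        by (intro expectation_cand_block_le) auto
    qed
  qed
  also have "\<dots> = 2 ^ qmin + (real L + 1) * vertex_bound n" by simp
  finally show ?thesis .
qed

text \<open>The leading 1 accounts for the index inserted in the current step, on top of the final
  set of the preceding step.\<close>

definition size_bound :: "nat \<Rightarrow> nat \<Rightarrow> real" where
  "size_bound L n = 1 + 2 ^ qmin + (real L + 1) * vertex_bound n"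

lemma size_bound_nonneg: "0 \<le> size_bound L n"
  by (simp add: size_bound_def vertex_bound_nonneg)

lemma expectation_card_cand_le_size_bound:
  assumes "k \<in> {1..n}" "n < 2 ^ (L + 1)" "qmin \<le> q"
  shows "expectation (\<lambda>\<omega>. real (card (cand k q \<omega>))) \<le> size_bound L n"
proof -
  obtain j where k: "k = Suc j" using assms(1) by (cases k) auto
  have "real (card (cand k q \<omega>)) \<le> 1 + real (card (cand j j \<omega>))" for \<omega>
    using of_nat_mono[OF card_candidates_Suc_le[OF assms(3)], where 'a = real] unfolding k by simp
  then have "expectation (\<lambda>\<omega>. real (card (cand k q \<omega>))) \<le> expectation (\<lambda>\<omega>. 1 + real (card (cand j j \<omega>)))"
    by (intro integral_mono integrable_card_cand Bochner_Integration.integrable_add integrable_const)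
  also have "\<dots> = 1 + expectation (\<lambda>\<omega>. real (card (cand j j \<omega>)))"
    by (subst Bochner_Integration.integral_add) (simp_all add: integrable_card_cand prob_space)
  also have "\<dots> \<le> size_bound L n"
    using expectation_card_cand_le[of j n L] assms k by (simp add: size_bound_def)
  finally show ?thesis .
qed

text \<open>The input of a hull call above level \<open>qmin\<close> consists of two half blocks
  that are already reduced to vertices, so no factor \<open>L\<close> arises. At level
  \<open>qmin\<close> the block length bounds the input.\<close>

lemma expectation_card_hull_input_le:
  assumes "qmin \<le> q" "2 ^ q dvd k" "k \<in> {1..n}"
  shows "expectation (\<lambda>\<omega>. real (card (cand k q \<omega> \<inter> {k - 2 ^ q<..k}))) \<le> 2 ^ qmin + 2 * vertex_bound n"
proof -
  have le: "2 ^ q \<le> k" using assms by (auto intro: dvd_imp_le)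
  show ?thesis
  proof (cases "q = qmin")
    case True
    have "card (cand k q \<omega> \<inter> {k - 2 ^ q<..k}) \<le> card {k - 2 ^ q<..k}" for \<omega>
      by (intro card_mono) auto
    then have "real (card (cand k q \<omega> \<inter> {k - 2 ^ q<..k})) \<le> 2 ^ qmin" for \<omega>
      using le True by (simp flip: of_nat_le_iff)
    then have "expectation (\<lambda>\<omega>. real (card (cand k q \<omega> \<inter> {k - 2 ^ q<..k}))) \<le> 2 ^ qmin"
      by (intro integral_le_const integrable_card_cand_Int) simp
    then show ?thesis using vertex_bound_nonneg[of n] by linarith
  next
    case False
    then obtain r where q: "q = Suc r" and r: "qmin \<le> r" using assms(1) by (cases q) auto
    define m where "m = k - 2 ^ q"
    have k: "k = m + 2 ^ r + 2 ^ r" using le by (simp add: m_def q)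
    have "2 ^ r dvd k" using assms(2) by (rule dvd_trans[rotated]) (simp add: q)
    then have dvd: "2 ^ r dvd m + 2 ^ r" "2 ^ r dvd m"
      unfolding k by (metis dvd_add_triv_right_iff)+
    have split: "{k - 2 ^ q<..k} = {m<..m + 2 ^ r} \<union> {m + 2 ^ r<..m + 2 ^ r + 2 ^ r}"
      unfolding m_def[symmetric] by (auto simp: k)
    have "real (card (cand k q \<omega> \<inter> {k - 2 ^ q<..k})) \<le> real (card (cand k q \<omega> \<inter> {m<..m + 2 ^ r})) +
        real (card (cand k q \<omega> \<inter> {m + 2 ^ r<..m + 2 ^ r + 2 ^ r}))" for \<omega>
      unfolding split Int_Un_distrib of_nat_add[symmetric] by (intro of_nat_mono card_Un_le)
    then have "expectation (\<lambda>\<omega>. real (card (cand k q \<omega> \<inter> {k - 2 ^ q<..k}))) \<le>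
        expectation (\<lambda>\<omega>. real (card (cand k q \<omega> \<inter> {m<..m + 2 ^ r})) +
          real (card (cand k q \<omega> \<inter> {m + 2 ^ r<..m + 2 ^ r + 2 ^ r})))"
      by (intro integral_mono Bochner_Integration.integrable_add integrable_card_cand_Int)
    also have "\<dots> = expectation (\<lambda>\<omega>. real (card (cand k q \<omega> \<inter> {m<..m + 2 ^ r}))) +
        expectation (\<lambda>\<omega>. real (card (cand k q \<omega> \<inter> {m + 2 ^ r<..m + 2 ^ r + 2 ^ r})))"
      by (intro Bochner_Integration.integral_add integrable_card_cand_Int)
    \<comment> \<open>The left half ends before \<open>k\<close>; the right half ends at
      \<open>k\<close> and was pruned at level \<open>r < q\<close> of the same loop.\<close>
    also have "\<dots> \<le> vertex_bound n + vertex_bound n"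
      using r dvd assms(3) by (intro add_mono expectation_cand_block_le) (auto simp: k q)
    finally show ?thesis using zero_le_power[of "2::real" qmin] by linarith
  qed
qed

end

subsection \<open>Expected costs\<close>

locale dyadic_costs = dyadic_walk M x qmin p c1 c2
  for M :: "'a measure" and x :: "nat \<Rightarrow> 'a \<Rightarrow> 'v::euclidean_space" and qmin p c1 c2 +
  fixes C :: "'v cost_model" and Time :: "nat \<Rightarrow> real" and c3 c4 b s :: real
  assumes c3: "0 \<le> c3" and c4: "0 \<le> c4"
    and Time: "\<And>m. Time m \<le> c3 * (real m)\<^sup>2 + c4"
    and hull_cost: "\<And>S. finite S \<Longrightarrow> 0 \<le> hull_cost C S \<and> hull_cost C S \<le> Time (card S)"
    and step_cost: "\<And>T. finite T \<Longrightarrow> 0 \<le> step_cost C T \<and> step_cost C T \<le> b * real (card T)"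
    and iter_cost: "\<And>q T. finite T \<Longrightarrow> 0 \<le> iter_cost C q T \<and> iter_cost C q T \<le> b * real (card T)"
    and stat_cost: "\<And>\<tau> n y. 0 \<le> stat_cost C \<tau> n y \<and> stat_cost C \<tau> n y \<le> s"
    and hull_cost_measurable: "\<And>I. finite I \<Longrightarrow> I \<subseteq> {1..} \<Longrightarrow>
      (\<lambda>\<omega>. hull_cost C (P (\<lambda>t. x t \<omega>) ` I)) \<in> borel_measurable M"
    and stat_cost_measurable: "\<And>\<tau> n. 1 \<le> \<tau> \<Longrightarrow> \<tau> \<le> n \<Longrightarrow>
      (\<lambda>\<omega>. stat_cost C \<tau> n (\<lambda>t. x t \<omega>)) \<in> borel_measurable M"
begin

abbreviation W :: "'a \<Rightarrow> nat \<Rightarrow> 'v" where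
  "W \<omega> \<equiv> \<lambda>t. x t \<omega>"

lemma b_nonneg: "0 \<le> b"
  using step_cost[of "{0}"] by simp

lemma s_nonneg: "0 \<le> s"
  using stat_cost[of 0 0 undefined] by simp

section \<open>Expected cost of one time step\<close>

lemma integrable_and_expectation_le:
  fixes f g :: "'a \<Rightarrow> real"
  assumes "f \<in> borel_measurable M" "integrable M g" "\<And>\<omega>. 0 \<le> f \<omega> \<and> f \<omega> \<le> g \<omega>"
  shows "integrable M f" "expectation f \<le> expectation g"
proof -
  have "norm (f \<omega>) \<le> norm (g \<omega>)" for \<omega>
    using assms(3)[of \<omega>] by simp
  then show "integrable M f"
    using assms(1,2) by (intro Bochner_Integration.integrable_bound[OF assms(2)]) simp_all
  then show "expectation f \<le> expectation g"
    using assms by (intro integral_mono) auto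
qed

lemma step_cost_expectation:
  assumes "k \<in> {1..n}" "n < 2 ^ (L + 1)"
  shows "integrable M (\<lambda>\<omega>. step_cost C (cand k qmin \<omega>))"
    and "expectation (\<lambda>\<omega>. step_cost C (cand k qmin \<omega>)) \<le> b * size_bound L n"
proof -
  have m: "(\<lambda>\<omega>. step_cost C (cand k qmin \<omega>)) \<in> borel_measurable M"
    by (rule measurable_cand[where f = "\<lambda>I \<omega>. step_cost C I"]) simp
  note * = integrable_and_expectation_le[OF m, of "\<lambda>\<omega>. b * real (card (cand k qmin \<omega>))"]
  show "integrable M (\<lambda>\<omega>. step_cost C (cand k qmin \<omega>))"
    by (rule *) (simp_all add: integrable_card_cand step_cost)
  have "expectation (\<lambda>\<omega>. step_cost C (cand k qmin \<omega>)) \<le> expectation (\<lambda>\<omega>. b * real (card (cand k qmin \<omega>)))"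
    by (rule *) (simp_all add: integrable_card_cand step_cost)
  also have "\<dots> = b * expectation (\<lambda>\<omega>. real (card (cand k qmin \<omega>)))" by simp
  also have "\<dots> \<le> b * size_bound L n"
    using assms by (intro mult_left_mono expectation_card_cand_le_size_bound b_nonneg) auto
  finally show "expectation (\<lambda>\<omega>. step_cost C (cand k qmin \<omega>)) \<le> b * size_bound L n" .
qed

lemma iter_cost_expectation:
  assumes "k \<in> {1..n}" "n < 2 ^ (L + 1)" "qmin \<le> q"
  shows "integrable M (\<lambda>\<omega>. iter_cost C q (cand k q \<omega>))"
    and "expectation (\<lambda>\<omega>. iter_cost C q (cand k q \<omega>)) \<le> b * size_bound L n"
proof -
  have m: "(\<lambda>\<omega>. iter_cost C q (cand k q \<omega>)) \<in> borel_measurable M"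
    by (rule measurable_cand[where f = "\<lambda>I \<omega>. iter_cost C q I"]) simp
  note * = integrable_and_expectation_le[OF m, of "\<lambda>\<omega>. b * real (card (cand k q \<omega>))"]
  show "integrable M (\<lambda>\<omega>. iter_cost C q (cand k q \<omega>))"
    by (rule *) (simp_all add: integrable_card_cand iter_cost)
  have "expectation (\<lambda>\<omega>. iter_cost C q (cand k q \<omega>)) \<le> expectation (\<lambda>\<omega>. b * real (card (cand k q \<omega>)))"
    by (rule *) (simp_all add: integrable_card_cand iter_cost)
  also have "\<dots> = b * expectation (\<lambda>\<omega>. real (card (cand k q \<omega>)))" by simp
  also have "\<dots> \<le> b * size_bound L n"
    using assms by (intro mult_left_mono expectation_card_cand_le_size_bound b_nonneg) auto
  finally show "expectation (\<lambda>\<omega>. iter_cost C q (cand k q \<omega>)) \<le> b * size_bound L n" .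
qed

text \<open>Assumption 1 bounds only the first moment of the input size of a hull call, so the
  quadratic cost is linearised with the trivial bound \<open>2 ^ q\<close> on that size.\<close>

lemma hull_cost_expectation:
  assumes "k \<in> {1..n}" "qmin \<le> q" "2 ^ q dvd k"
  shows "integrable M (\<lambda>\<omega>. hull_cost C (P (W \<omega>) ` (cand k q \<omega> \<inter> {k - 2 ^ q<..k})))"
    and "expectation (\<lambda>\<omega>. hull_cost C (P (W \<omega>) ` (cand k q \<omega> \<inter> {k - 2 ^ q<..k}))) \<le>
      c3 * 2 ^ q * (2 ^ qmin + 2 * vertex_bound n) + c4"
proof -
  let ?B = "{k - 2 ^ q<..k}"
  let ?g = "\<lambda>\<omega>. c3 * 2 ^ q * real (card (cand k q \<omega> \<inter> ?B)) + c4"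
  have le: "2 ^ q \<le> k" using assms by (auto intro: dvd_imp_le)
  have m: "(\<lambda>\<omega>. hull_cost C (P (W \<omega>) ` (cand k q \<omega> \<inter> ?B))) \<in> borel_measurable M"
    by (rule measurable_cand[where f = "\<lambda>I \<omega>. hull_cost C (P (W \<omega>) ` (I \<inter> ?B))"],
        rule hull_cost_measurable) auto
  have int: "integrable M ?g"
    by (intro Bochner_Integration.integrable_add integrable_mult_right integrable_card_cand_Int
        integrable_const)
  have bound: "0 \<le> hull_cost C (P (W \<omega>) ` (cand k q \<omega> \<inter> ?B)) \<and>
      hull_cost C (P (W \<omega>) ` (cand k q \<omega> \<inter> ?B)) \<le> ?g \<omega>" for \<omega>
  proof -
    define N where "N = real (card (cand k q \<omega> \<inter> ?B))"
    have fin: "finite (P (W \<omega>) ` (cand k q \<omega> \<inter> ?B))" by simp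
    have "card (cand k q \<omega> \<inter> ?B) \<le> card ?B" by (intro card_mono) auto
    then have "N \<le> 2 ^ q" using le by (simp add: N_def flip: of_nat_le_iff)
    then have "N\<^sup>2 \<le> 2 ^ q * N" unfolding power2_eq_square by (intro mult_right_mono) (auto simp: N_def)
    moreover have "hull_cost C (P (W \<omega>) ` (cand k q \<omega> \<inter> ?B)) \<le> c3 * N\<^sup>2 + c4"
      using hull_cost[OF fin] Time[of "card (cand k q \<omega> \<inter> ?B)"]
      by (simp add: card_image inj_P N_def)
    ultimately have "hull_cost C (P (W \<omega>) ` (cand k q \<omega> \<inter> ?B)) \<le> c3 * (2 ^ q * N) + c4"
      using mult_left_mono[OF _ c3, of "N\<^sup>2" "2 ^ q * N"] by linarith
    then show ?thesis using hull_cost[OF fin] by (simp add: N_def mult.assoc)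
  qed
  show "integrable M (\<lambda>\<omega>. hull_cost C (P (W \<omega>) ` (cand k q \<omega> \<inter> ?B)))"
    by (rule integrable_and_expectation_le[OF m int bound])
  have "expectation (\<lambda>\<omega>. hull_cost C (P (W \<omega>) ` (cand k q \<omega> \<inter> ?B))) \<le> expectation ?g"
    by (rule integrable_and_expectation_le[OF m int bound])
  also have "\<dots> = c3 * 2 ^ q * expectation (\<lambda>\<omega>. real (card (cand k q \<omega> \<inter> ?B))) + c4"
    by (subst Bochner_Integration.integral_add) (simp_all add: integrable_card_cand_Int prob_space)
  also have "\<dots> \<le> c3 * 2 ^ q * (2 ^ qmin + 2 * vertex_bound n) + c4"
    using assms c3 by (intro add_right_mono mult_left_mono expectation_card_hull_input_le) auto
  finally show "expectation (\<lambda>\<omega>. hull_cost C (P (W \<omega>) ` (cand k q \<omega> \<inter> ?B))) \<le>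
    c3 * 2 ^ q * (2 ^ qmin + 2 * vertex_bound n) + c4" .
qed

lemma stat_cost_expectation:
  assumes "k \<in> {1..n}" "n < 2 ^ (L + 1)"
  shows "integrable M (\<lambda>\<omega>. \<Sum>\<tau>\<in>cand k k \<omega>. stat_cost C \<tau> k (W \<omega>))"
    and "expectation (\<lambda>\<omega>. \<Sum>\<tau>\<in>cand k k \<omega>. stat_cost C \<tau> k (W \<omega>)) \<le> s * size_bound L n"
proof -
  let ?f = "\<lambda>\<omega>. \<Sum>\<tau>\<in>cand k k \<omega>. stat_cost C \<tau> k (W \<omega>)"
  have m: "?f \<in> borel_measurable M"
  proof (rule measurable_cand[where f = "\<lambda>I \<omega>. \<Sum>\<tau>\<in>I. stat_cost C \<tau> k (W \<omega>)"])
    show "(\<lambda>\<omega>. \<Sum>\<tau>\<in>I. stat_cost C \<tau> k (W \<omega>)) \<in> borel_measurable M" if "I \<subseteq> {1..k}" for I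
      using that by (intro borel_measurable_sum stat_cost_measurable) auto
  qed
  have bound: "0 \<le> ?f \<omega> \<and> ?f \<omega> \<le> s * real (card (cand k k \<omega>))" for \<omega>
    using stat_cost sum_bounded_above[of "cand k k \<omega>" "\<lambda>\<tau>. stat_cost C \<tau> k (W \<omega>)" s]
    by (simp add: sum_nonneg mult.commute)
  have int: "integrable M (\<lambda>\<omega>. s * real (card (cand k k \<omega>)))"
    by (intro integrable_mult_right integrable_card_cand)
  show "integrable M ?f"
    by (rule integrable_and_expectation_le[OF m int bound])
  have "expectation ?f \<le> expectation (\<lambda>\<omega>. s * real (card (cand k k \<omega>)))"
    by (rule integrable_and_expectation_le[OF m int bound])
  also have "\<dots> = s * expectation (\<lambda>\<omega>. real (card (cand k k \<omega>)))" by simp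
  also have "\<dots> \<le> s * (2 ^ qmin + (real L + 1) * vertex_bound n)"
    using assms by (intro mult_left_mono expectation_card_cand_le s_nonneg) auto
  also have "\<dots> \<le> s * size_bound L n"
    by (intro mult_left_mono s_nonneg) (simp add: size_bound_def)
  finally show "expectation ?f \<le> s * size_bound L n" .
qed

lemma round_cost_expectation:
  assumes k: "k \<in> {1..n}" and n: "n < 2 ^ (L + 1)"
  shows "integrable M (\<lambda>\<omega>. round_cost C qmin (W \<omega>) k)"
    and "expectation (\<lambda>\<omega>. round_cost C qmin (W \<omega>) k) \<le> b * size_bound L n +
      (\<Sum>r | qmin \<le> r \<and> 2 ^ r dvd k. c3 * 2 ^ r * (2 ^ qmin + 2 * vertex_bound n) + c4 + b * size_bound L n)"
proof -
  show "integrable M (\<lambda>\<omega>. round_cost C qmin (W \<omega>) k)"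
    unfolding round_cost_def
    by (intro Bochner_Integration.integrable_add Bochner_Integration.integrable_sum
        step_cost_expectation[OF k n] iter_cost_expectation[OF k n] hull_cost_expectation[OF k]) auto
  let ?R = "{r. qmin \<le> r \<and> 2 ^ r dvd k}"
  let ?h = "\<lambda>r \<omega>. hull_cost C (P (W \<omega>) ` (cand k r \<omega> \<inter> {k - 2 ^ r<..k}))"
  let ?i = "\<lambda>r \<omega>. iter_cost C r (cand k r \<omega>)"
  note ints = step_cost_expectation(1)[OF k n] iter_cost_expectation(1)[OF k n]
    hull_cost_expectation(1)[OF k]
  have "expectation (\<lambda>\<omega>. round_cost C qmin (W \<omega>) k) =
      expectation (\<lambda>\<omega>. step_cost C (cand k qmin \<omega>)) + expectation (\<lambda>\<omega>. \<Sum>r\<in>?R. ?h r \<omega> + ?i r \<omega>)"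
    unfolding round_cost_def
    by (intro Bochner_Integration.integral_add Bochner_Integration.integrable_add
        Bochner_Integration.integrable_sum ints) auto
  also have "expectation (\<lambda>\<omega>. \<Sum>r\<in>?R. ?h r \<omega> + ?i r \<omega>) = (\<Sum>r\<in>?R. expectation (\<lambda>\<omega>. ?h r \<omega> + ?i r \<omega>))"
    by (intro Bochner_Integration.integral_sum Bochner_Integration.integrable_add ints) auto
  also have "\<dots> = (\<Sum>r\<in>?R. expectation (?h r) + expectation (?i r))"
    by (intro sum.cong refl Bochner_Integration.integral_add ints) auto
  also have "expectation (\<lambda>\<omega>. step_cost C (cand k qmin \<omega>)) + \<dots> \<le> b * size_bound L n +
      (\<Sum>r | qmin \<le> r \<and> 2 ^ r dvd k. c3 * 2 ^ r * (2 ^ qmin + 2 * vertex_bound n) + c4 + b * size_bound L n)"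
    by (intro add_mono sum_mono step_cost_expectation[OF k n] iter_cost_expectation[OF k n]
        hull_cost_expectation[OF k]) auto
  finally show "expectation (\<lambda>\<omega>. round_cost C qmin (W \<omega>) k) \<le> b * size_bound L n +
      (\<Sum>r | qmin \<le> r \<and> 2 ^ r dvd k. c3 * 2 ^ r * (2 ^ qmin + 2 * vertex_bound n) + c4 + b * size_bound L n)" .
qed

section \<open>Accumulated cost and its growth rate\<close>

lemma ex_levels: "\<exists>L. (n::nat) < 2 ^ (L + 1)"
  by (rule exI[of _ n], rule order.strict_trans2[OF less_exp]) simp

lemma integrable_md_focus_cost: "integrable M (\<lambda>\<omega>. md_focus_cost C ell H qmin (W \<omega>) n)"
proof -
  obtain L where "n < 2 ^ (L + 1)" using ex_levels by blast
  then show ?thesis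
    unfolding md_focus_cost_eq
    by (intro Bochner_Integration.integrable_sum Bochner_Integration.integrable_add
        round_cost_expectation stat_cost_expectation) auto
qed

lemma integrable_dyadic_cost: "integrable M (\<lambda>\<omega>. dyadic_cost C qmin (W \<omega>) n)"
proof -
  obtain L where "n < 2 ^ (L + 1)" using ex_levels by blast
  then show ?thesis
    unfolding dyadic_cost_eq
    by (intro Bochner_Integration.integrable_sum round_cost_expectation) auto
qed

lemma dyadic_cost_nonneg: "0 \<le> dyadic_cost C qmin y n"
  unfolding dyadic_cost_eq round_cost_def
  by (intro sum_nonneg add_nonneg_nonneg) (simp_all add: step_cost hull_cost iter_cost)

text \<open>Both algorithms keep the same index sets, and the second one adds nonnegative evaluation
  costs. One upper bound therefore serves both.\<close>

lemma dyadic_cost_le_md_focus_cost: "dyadic_cost C qmin y n \<le> md_focus_cost C ell H qmin y n"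
  unfolding dyadic_cost_eq md_focus_cost_eq
  by (intro sum_mono) (simp add: sum_nonneg stat_cost)

lemma expectation_md_focus_cost_le:
  assumes n: "n < 2 ^ (L + 1)"
  shows "expectation (\<lambda>\<omega>. md_focus_cost C ell H qmin (W \<omega>) n) \<le>
    (3 * b + s + 2 * c3 + 2 * c4) * (real n * (real L + 1) * (1 + 2 ^ qmin + vertex_bound n))"
proof -
  \<comment> \<open>\<open>Y\<close> bounds the expected hull input; \<open>Z\<close> collects the
    part of an iteration's cost that does not grow with the block length.\<close>
  define Y where "Y = 2 ^ qmin + 2 * vertex_bound n"
  define Z where "Z = c4 + b * size_bound L n"
  have Y: "0 \<le> Y" and Z: "0 \<le> Z"
    using vertex_bound_nonneg[of n] size_bound_nonneg c4 b_nonneg by (simp_all add: Y_def Z_def)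
  have "expectation (\<lambda>\<omega>. md_focus_cost C ell H qmin (W \<omega>) n) =
      (\<Sum>k=1..n. expectation (\<lambda>\<omega>. round_cost C qmin (W \<omega>) k) +
        expectation (\<lambda>\<omega>. \<Sum>\<tau>\<in>cand k k \<omega>. stat_cost C \<tau> k (W \<omega>)))"
    unfolding md_focus_cost_eq
    by (simp add: Bochner_Integration.integral_sum Bochner_Integration.integral_add
        round_cost_expectation(1)[OF _ n] stat_cost_expectation(1)[OF _ n])
  also have "\<dots> \<le> (\<Sum>k=1..n. b * size_bound L n +
      (\<Sum>r | qmin \<le> r \<and> 2 ^ r dvd k. c3 * 2 ^ r * Y + Z) + s * size_bound L n)"
    using round_cost_expectation(2)[OF _ n] stat_cost_expectation(2)[OF _ n]
    by (intro sum_mono add_mono) (simp_all add: Y_def Z_def add.assoc)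
  also have "\<dots> = real n * ((b + s) * size_bound L n) + (\<Sum>k=1..n. \<Sum>r | qmin \<le> r \<and> 2 ^ r dvd k. c3 * 2 ^ r * Y + Z)"
    by (simp add: sum.distrib algebra_simps)
  also have "(\<Sum>k=1..n. \<Sum>r | qmin \<le> r \<and> 2 ^ r dvd k. c3 * 2 ^ r * Y + Z) \<le>
      (\<Sum>r\<le>L. real n / 2 ^ r * (c3 * 2 ^ r * Y + Z))"
    using c3 Y Z n by (intro sum_dyadic_levels_le) auto
  \<comment> \<open>The block length cancels against the number of calls: the \<open>Y\<close> part
    contributes equally at each of the \<open>L + 1\<close> levels, while the \<open>Z\<close> part
    sums geometrically.\<close>
  also have "\<dots> = (\<Sum>r\<le>L. real n * c3 * Y + real n * Z * (1 / 2 ^ r))"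
    by (intro sum.cong) (auto simp: field_simps)
  also have "\<dots> = real n * c3 * Y * (real L + 1) + real n * Z * (\<Sum>r\<le>L. 1 / 2 ^ r)"
    by (simp add: sum.distrib sum_distrib_left algebra_simps)
  also have "\<dots> \<le> real n * c3 * Y * (real L + 1) + real n * Z * 2"
    using Z by (intro add_left_mono mult_left_mono sum_inverse_powers_2_le) auto
  finally have "expectation (\<lambda>\<omega>. md_focus_cost C ell H qmin (W \<omega>) n) \<le>
      real n * ((b + s) * size_bound L n + c3 * (Y * (real L + 1)) + 2 * Z)"
    by (simp add: algebra_simps)
  also have "\<dots> \<le> real n * ((3 * b + s + 2 * c3 + 2 * c4) * ((real L + 1) * (1 + 2 ^ qmin + vertex_bound n)))"
  proof (rule mult_left_mono)
    define U where "U = (real L + 1) * (1 + 2 ^ qmin + vertex_bound n)"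
    have size_bound: "size_bound L n \<le> U"
      using vertex_bound_nonneg[of n] by (simp add: size_bound_def U_def algebra_simps)
    have "Y \<le> 2 * (1 + 2 ^ qmin + vertex_bound n)"
      by (simp add: Y_def)
    then have YU: "Y * (real L + 1) \<le> 2 * U"
      using mult_right_mono[of Y "2 * (1 + 2 ^ qmin + vertex_bound n)" "real L + 1"] by (simp add: U_def mult_ac)
    \<comment> \<open>This lets \<open>U\<close> absorb the additive constant \<open>c4\<close>. In
      the total, \<open>3 * b\<close> is \<open>b\<close> from the time step and
      \<open>2 * b\<close> from \<open>2 * Z\<close>.\<close>
    have "1 * 1 \<le> U"
      unfolding U_def using vertex_bound_nonneg[of n] by (intro mult_mono) auto
    then have "c4 \<le> c4 * U"
      using c4 mult_left_mono[of 1 U c4] by simp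
    then have "(b + s) * size_bound L n + c3 * (Y * (real L + 1)) + 2 * Z \<le>
        (b + s) * U + c3 * (2 * U) + 2 * (c4 * U + b * U)"
      unfolding Z_def using b_nonneg s_nonneg c3 size_bound YU
      by (intro add_mono mult_left_mono[of _ _ 2] mult_left_mono[of "size_bound L n" U] mult_left_mono[of _ _ c3]) auto
    also have "\<dots> = (3 * b + s + 2 * c3 + 2 * c4) * U"
      by (simp add: algebra_simps)
    finally show "(b + s) * size_bound L n + c3 * (Y * (real L + 1)) + 2 * Z \<le>
        (3 * b + s + 2 * c3 + 2 * c4) * ((real L + 1) * (1 + 2 ^ qmin + vertex_bound n))"
      by (simp only: U_def)
  qed simp
  finally show ?thesis by (simp add: mult_ac)
qed

lemma expectation_md_focus_cost_eventually_le:
  "\<exists>K. \<forall>n\<ge>3. expectation (\<lambda>\<omega>. md_focus_cost C ell H qmin (W \<omega>) n) \<le>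
    K * (real n * ln (real n) ^ (p + 1))"
\<comment> \<open>The witness for \<open>K\<close> stays schematic and is fixed by the final
  inequality. The threshold 3 exceeds \<open>exp 1\<close>, so that \<open>ln (real n)\<close> is at
  least 1 and its powers absorb constants.\<close>
proof (intro exI allI impI)
  fix n :: nat assume n3: "3 \<le> n"
  define l where "l = ln (real n)"
  define A where "A = 3 * b + s + 2 * c3 + 2 * c4"
  \<comment> \<open>The factor \<open>2 ^ p\<close> comes from
    \<open>ln (real n + 1) \<le> 2 * l\<close>, a consequence of
    \<open>n + 1 \<le> n * n\<close>.\<close>
  define D where "D = 1 + 2 ^ qmin + c1 * 2 ^ p + c2"
  have l: "1 \<le> l"
  proof -
    have "exp 1 \<le> (3::real)" using exp_le by simp
    also have "\<dots> \<le> real n" using n3 by simp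
    finally have "ln (exp 1) \<le> l" unfolding l_def using n3 by (subst ln_le_cancel_iff) auto
    then show ?thesis by simp
  qed
  have lp: "1 \<le> l ^ p" using l by (rule one_le_power)
  \<comment> \<open>\<open>L\<close> is the integer part of the binary logarithm of
    \<open>n\<close>. As \<open>ln 2\<close> exceeds one half, it is at most \<open>2 * l\<close>,
    and the extra 1 costs another \<open>l\<close>.\<close>
  obtain L where L: "2 ^ L \<le> n" "n < 2 ^ (L + 1)"
    using ex_power_ivl1[of 2 n] n3 by auto
  have "real L * ln 2 = ln (2 ^ L)" by (simp add: ln_realpow)
  also have "\<dots> \<le> l"
    unfolding l_def using L(1) n3 by (subst ln_le_cancel_iff) (simp_all flip: of_nat_le_iff)
  finally have "real L * ln 2 \<le> l" .
  moreover have "real L * (1 / 2) \<le> real L * ln 2"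
    using ln2_ge_two_thirds by (intro mult_left_mono) auto
  ultimately have L3: "real L + 1 \<le> 3 * l" using l by linarith
  have "3 * real n \<le> real n * real n" using n3 by (intro mult_right_mono) auto
  then have "real n + 1 \<le> real n * real n" using n3 by linarith
  then have "ln (real n + 1) \<le> ln (real n * real n)"
    using n3 by (subst ln_le_cancel_iff) auto
  also have "\<dots> = 2 * l" using n3 by (simp add: ln_mult l_def)
  finally have "ln (real n + 1) ^ p \<le> (2 * l) ^ p" by (rule power_mono) simp
  then have "c1 * ln (real n + 1) ^ p \<le> c1 * (2 ^ p * l ^ p)"
    unfolding power_mult_distrib using c1 by (rule mult_left_mono)
  moreover have "(1 + 2 ^ qmin + c2) * 1 \<le> (1 + 2 ^ qmin + c2) * l ^ p"
    using lp c2 by (intro mult_left_mono) auto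
  ultimately have "1 + 2 ^ qmin + vertex_bound n \<le> D * l ^ p"
    by (simp add: vertex_bound_def D_def algebra_simps)
  then have "(real L + 1) * (1 + 2 ^ qmin + vertex_bound n) \<le> (3 * l) * (D * l ^ p)"
    using L3 l vertex_bound_nonneg[of n] by (intro mult_mono) auto
  then have "A * (real n * ((real L + 1) * (1 + 2 ^ qmin + vertex_bound n))) \<le>
      A * (real n * ((3 * l) * (D * l ^ p)))"
    using b_nonneg s_nonneg c3 c4 unfolding A_def by (intro mult_left_mono) auto
  moreover have "expectation (\<lambda>\<omega>. md_focus_cost C ell H qmin (W \<omega>) n) \<le>
      A * (real n * ((real L + 1) * (1 + 2 ^ qmin + vertex_bound n)))"
    using expectation_md_focus_cost_le[OF L(2)] by (simp add: A_def mult.assoc)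
  ultimately have "expectation (\<lambda>\<omega>. md_focus_cost C ell H qmin (W \<omega>) n) \<le>
      A * (real n * ((3 * l) * (D * l ^ p)))"
    by linarith
  also have "\<dots> = (A * 3 * D) * (real n * ln (real n) ^ (p + 1))"
    by (simp add: l_def)
  finally show "expectation (\<lambda>\<omega>. md_focus_cost C ell H qmin (W \<omega>) n) \<le>
      ((3 * b + s + 2 * c3 + 2 * c4) * 3 * (1 + 2 ^ qmin + c1 * 2 ^ p + c2)) *
        (real n * ln (real n) ^ (p + 1))"
    by (simp only: A_def D_def)
qed

lemma expected_costs_bigo:
  "(\<lambda>n. expectation (\<lambda>\<omega>. dyadic_cost C qmin (W \<omega>) n)) \<in> O(\<lambda>n. real n * ln (real n) ^ (p + 1))"
  "(\<lambda>n. expectation (\<lambda>\<omega>. md_focus_cost C ell H qmin (W \<omega>) n)) \<in> O(\<lambda>n. real n * ln (real n) ^ (p + 1))"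
proof -
  obtain K where K: "\<And>n. 3 \<le> n \<Longrightarrow> expectation (\<lambda>\<omega>. md_focus_cost C ell H qmin (W \<omega>) n) \<le>
      K * (real n * ln (real n) ^ (p + 1))"
    using expectation_md_focus_cost_eventually_le by blast
  have le: "0 \<le> expectation (\<lambda>\<omega>. dyadic_cost C qmin (W \<omega>) n)"
    "expectation (\<lambda>\<omega>. dyadic_cost C qmin (W \<omega>) n) \<le> expectation (\<lambda>\<omega>. md_focus_cost C ell H qmin (W \<omega>) n)" for n
    by (intro Bochner_Integration.integral_nonneg dyadic_cost_nonneg integral_mono
        integrable_dyadic_cost integrable_md_focus_cost dyadic_cost_le_md_focus_cost)+
  show "(\<lambda>n. expectation (\<lambda>\<omega>. md_focus_cost C ell H qmin (W \<omega>) n)) \<in> O(\<lambda>n. real n * ln (real n) ^ (p + 1))"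
  proof (rule bigoI[of _ K], rule eventually_sequentiallyI[of 3])
    fix n :: nat assume "3 \<le> n"
    then show "norm (expectation (\<lambda>\<omega>. md_focus_cost C ell H qmin (W \<omega>) n)) \<le>
        K * norm (real n * ln (real n) ^ (p + 1))"
      using K[of n] le[of n] by simp
  qed
  then show "(\<lambda>n. expectation (\<lambda>\<omega>. dyadic_cost C qmin (W \<omega>) n)) \<in> O(\<lambda>n. real n * ln (real n) ^ (p + 1))"
    by (rule landau_o.big_mono[THEN landau_o.big_trans, rotated])
      (use le order.trans[OF le] in \<open>auto intro!: always_eventually\<close>)
qed

end

theorem lemma1:
  fixes M :: "'a measure"
    and x :: "nat \<Rightarrow> 'a \<Rightarrow> real ^ 'p"
    and C :: "(real ^ 'p) cost_model"
    and Time :: "nat \<Rightarrow> real"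
    and ell :: "nat \<Rightarrow> nat \<Rightarrow> 'e \<Rightarrow> 'e \<Rightarrow> (nat \<Rightarrow> real ^ 'p) \<Rightarrow> real"
    and H :: "('e \<times> 'e) set"
    and qmin :: nat
    and c1 c2 c3 c4 b s :: real
  assumes "prob_space M"
    and indep: "prob_space.indep_vars M (\<lambda>_. borel) x {1..}"
    and ident: "\<And>t. t \<ge> 1 \<Longrightarrow> distr M borel (x t) = distr M borel (x 1)"
    and "c1 > 0" "c2 > 0" "c3 > 0" "c4 > 0"
    and assumption1: "\<And>n. n \<ge> 1 \<Longrightarrow>
      prob_space.expectation M (\<lambda>\<omega>. real (num_vertices (\<lambda>t. x t \<omega>) n))
        \<le> c1 * ln (real n) ^ CARD('p) + c2"
    and assumption2: "\<And>m. Time m \<le> c3 * (real m)\<^sup>2 + c4"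
    and hull_cost: "\<And>S. finite S \<Longrightarrow> 0 \<le> hull_cost C S \<and> hull_cost C S \<le> Time (card S)"
    and step_cost: "\<And>T. finite T \<Longrightarrow> 0 \<le> step_cost C T \<and> step_cost C T \<le> b * real (card T)"
    and iter_cost: "\<And>q T. finite T \<Longrightarrow> 0 \<le> iter_cost C q T \<and> iter_cost C q T \<le> b * real (card T)"
    and stat_cost: "\<And>\<tau> n y. 0 \<le> stat_cost C \<tau> n y \<and> stat_cost C \<tau> n y \<le> s"
    and hull_cost_measurable: "\<And>I. finite I \<Longrightarrow> I \<subseteq> {1..} \<Longrightarrow>
      (\<lambda>\<omega>. hull_cost C (P (\<lambda>t. x t \<omega>) ` I)) \<in> borel_measurable M"
    and stat_cost_measurable: "\<And>\<tau> n. 1 \<le> \<tau> \<Longrightarrow> \<tau> \<le> n \<Longrightarrow>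
      (\<lambda>\<omega>. stat_cost C \<tau> n (\<lambda>t. x t \<omega>)) \<in> borel_measurable M"
  shows "(\<forall>n. integrable M (\<lambda>\<omega>. dyadic_cost C qmin (\<lambda>t. x t \<omega>) n)) \<and>
    (\<lambda>n. prob_space.expectation M (\<lambda>\<omega>. dyadic_cost C qmin (\<lambda>t. x t \<omega>) n))
      \<in> O(\<lambda>n. real n * ln (real n) ^ (CARD('p) + 1)) \<and>
    (\<forall>n. integrable M (\<lambda>\<omega>. md_focus_cost C ell H qmin (\<lambda>t. x t \<omega>) n)) \<and>
    (\<lambda>n. prob_space.expectation M (\<lambda>\<omega>. md_focus_cost C ell H qmin (\<lambda>t. x t \<omega>) n))
      \<in> O(\<lambda>n. real n * ln (real n) ^ (CARD('p) + 1))"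
proof -
  interpret prob_space M by fact
  interpret dyadic_costs M x qmin "CARD('p)" c1 c2 C Time c3 c4 b s
    by (unfold_locales; rule indep ident assumption1 assumption2 hull_cost step_cost iter_cost
        stat_cost hull_cost_measurable stat_cost_measurable \<open>c1 > 0\<close>[THEN less_imp_le]
        \<open>c2 > 0\<close>[THEN less_imp_le] \<open>c3 > 0\<close>[THEN less_imp_le] \<open>c4 > 0\<close>[THEN less_imp_le]; assumption)
  show ?thesis
    by (intro conjI allI integrable_dyadic_cost integrable_md_focus_cost expected_costs_bigo)
qed

end
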